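(* Let $n\ge 3$ be an integer. Among all convex polygons $K\subset\mathbb{R}^2$ (with nonempty interior) having at most $n$ vertices and whose Santaló point is the origin $o$, the polygons maximizing the area product $V(K)\,V(K^* )$ are exactly the images of regular $n$-gons with centre at $o$ under non-singular linear maps of $\mathbb{R}^2$.
   Context: $V(\cdot)$ denotes area. For a convex body $M\subset\mathbb{R}^2$ with $o\in\operatorname{int}M$, $M^*=\{x\in\mathbb{R}^2:\langle x,y\rangle\le 1\text{ for all }y\in M\}$ is the polar body. The Santaló point $s(K)$ of a convex body $K$ is the unique point $z\in\operatorname{int}K$ at which the function $z\mapsto V((K-z)^* )$ on $\operatorname{int}K$ attains its minimum. *)

theory Defs
  imports "HOL-Analysis.Analysis"
begin

abbreviation area :: "(real^2) set \<Rightarrow> real" where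
  "area \<equiv> measure lebesgue"

definition polar_body :: "(real^2) set \<Rightarrow> (real^2) set" where
  "polar_body M = {x. \<forall>y\<in>M. x \<bullet> y \<le> 1}"

definition polar_area_at :: "(real^2) set \<Rightarrow> real^2 \<Rightarrow> real" where
  "polar_area_at K z = area (polar_body ((\<lambda>x. x - z) ` K))"

(* z is the unique minimizer over the interior of K.  For a convex body K and z in its
   interior the translated polar is compact, so its measure is never a junk value. *)
definition is_santalo_point :: "(real^2) set \<Rightarrow> real^2 \<Rightarrow> bool" where
  "is_santalo_point K z \<longleftrightarrow>
     z \<in> interior K \<and> (\<forall>w\<in>interior K. w \<noteq> z \<longrightarrow> polar_area_at K z < polar_area_at K w)"

(* A polytope has finitely many extreme points, so card is the true number of vertices. *)
definition santalo_centred_polygons :: "nat \<Rightarrow> (real^2) set set" where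
  "santalo_centred_polygons n =
     {K. polytope K \<and> interior K \<noteq> {} \<and> card {v. v extreme_point_of K} \<le> n \<and>
         is_santalo_point K 0}"

definition area_product :: "(real^2) set \<Rightarrow> real" where
  "area_product K = area K * area (polar_body K)"

definition regular_polygon :: "nat \<Rightarrow> real \<Rightarrow> real \<Rightarrow> (real^2) set" where
  "regular_polygon n r \<theta> =
     convex hull ((\<lambda>k. vector [r * cos (\<theta> + 2 * pi * real k / real n),
                               r * sin (\<theta> + 2 * pi * real k / real n)]) ` {..<n})"

end

theory Submission
  imports Defs
begin

text \<open>Let K be a convex polygon with vertices v_i in counterclockwise order, i < m, and let z be an
  interior point. Put d_i = det(v_i - z, v_(i+1) - z), and let delta_i be the analogous determinants
  for the polar polygon of K - z. Then D = d_0 + ... + d_(m-1) is twice the area of K, and the sum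
  of the delta_i is twice the area of the polar body. As the Santalo point minimizes the latter, an
  upper bound at any single point z is enough.

  Choose z such that the masses delta_i, placed at the points y_i of the unit circle whose
  successive angular distances are 2 pi d_i / D, have barycentre 0. Such a z exists since the
  barycentre map winds once around 0 along the boundary of K. By Minkowski's inequality for mixed
  areas the coordinates of y satisfy sum delta_i y_i^2 <= sum (y_(i+1) - y_i)^2 / d_i.
  Adding the two coordinates gives sum delta_i <= sum 4 sin^2 (pi d_i / D) / d_i, and a tangent line
  estimate for sin^2 (pi x) / x at x = 1 / n bounds D times the right-hand side by
  4 n^2 sin^2 (pi / n).

  In the case of equality m = n, all d_i agree, and y is a null vector of the mixed area form, so
  that v_i - z satisfies the same second order recursion as the vertices of a regular n-gon;
  moreover z is the Santalo point.\<close>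

section \<open>A tangent line estimate\<close>

text \<open>The inequality is spectral. On the cycle of vertices take conductances 1 / d_i and
  masses delta_i: the coordinates of v_i - z are eigenfunctions of the weighted Laplacian with
  eigenvalue 1, and Minkowski's inequality says that 1 is its first nonzero eigenvalue. The rest
  follows Hersch's argument for the sphere: the trial functions are coordinates of points on a unit
  circle, since their squares add up to 1 and leave just the sum of the delta_i, and orthogonality
  to the constants is gained by the choice of z, in place of a conformal map. Hence z is a balanced
  point and not a priori the Santalo point. Angular steps proportional to d_i make each summand a
  function of d_i / D alone, up to the factor 1 / D; this reduces the last estimate to one variable.
  The factor 4 cancels because D times the sum of the delta_i is four times the area product. Fewer
  than n vertices need no separate argument: the tangent at 1 / n has a positive intercept, so fewer
  summands give a smaller bound.\<close>

lemma sin_less_self: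
  fixes x :: real
  assumes "0 < x"
  shows "sin x < x"
proof (cases "x > 1")
  case True
  then show ?thesis using sin_le_one[of x] by linarith
next
  case False
  obtain z where z: "0 < z" "z < x" "sin x - sin 0 = (x - 0) * cos z"
    using MVT2[of 0 x sin cos] assms by (auto intro: DERIV_sin)
  have "cos z < cos 0"
    by (rule cos_monotone_0_pi) (use z False pi_gt3 in auto)
  then show ?thesis using z assms by simp
qed

lemma mult_cos_less_sin:
  fixes x :: real
  assumes "0 < x" "x \<le> pi"
  shows "x * cos x < sin x"
proof -
  obtain z where z: "0 < z" "z < x" "sin x - sin 0 = (x - 0) * cos z"
    using MVT2[of 0 x sin cos] assms by (auto intro: DERIV_sin)
  have "cos x < cos z"
    by (rule cos_monotone_0_pi) (use z assms in auto)
  then show ?thesis using z assms by simp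
qed

text \<open>The right-hand side is \<^term>\<open>t\<close> times the tangent at \<^term>\<open>\<theta>\<close> of the function mapping
  \<^term>\<open>t\<close> to \<^term>\<open>(sin t)\<^sup>2 / t\<close>, which is not concave on all of \<^term>\<open>{0..pi}\<close>.\<close>
lemma sin_sq_less_quadratic:
  fixes \<theta> t :: real
  defines "a \<equiv> 2 * sin \<theta> * (sin \<theta> / \<theta> - cos \<theta>)"
    and "b \<equiv> sin \<theta> / \<theta> * (2 * cos \<theta> - sin \<theta> / \<theta>)"
  assumes \<theta>: "0 < \<theta>" "\<theta> \<le> pi / 3" and t: "0 < t" "t \<noteq> \<theta>"
  shows "(sin t)\<^sup>2 < a * t + b * t\<^sup>2"
proof -
  define S C where "S = sin \<theta>" and "C = cos \<theta>"
  have S0: "S > 0" unfolding S_def using \<theta> by (intro sin_gt_zero) auto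
  have C0: "C \<ge> 1/2"
    unfolding C_def using cos_monotone_0_pi_le[of \<theta> "pi/3"] \<theta> by (auto simp: cos_60)
  have S\<theta>: "S < \<theta>" unfolding S_def using sin_less_self \<theta> by simp
  have C\<theta>: "\<theta> * C < S" unfolding S_def C_def using mult_cos_less_sin \<theta> by simp
  have SC1: "S\<^sup>2 + C\<^sup>2 = 1" by (simp add: S_def C_def)
  have q1: "S / \<theta> < 1" "S / \<theta> > 0" "S / \<theta> > C" using S\<theta> S0 \<theta> C\<theta> by (auto simp: field_simps)
  \<comment> \<open>Here \<open>\<theta> \<le> pi / 3\<close> enters: it gives
    \<open>2 * C \<ge> 1 > S / \<theta>\<close>.\<close>
  have b0: "b \<ge> 0" unfolding b_def S_def[symmetric] C_def[symmetric]
    using q1 C0 by (intro mult_nonneg_nonneg) auto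
  have a\<theta>: "a * \<theta> + b * \<theta>\<^sup>2 = S\<^sup>2" unfolding a_def b_def S_def[symmetric] C_def[symmetric]
    using \<theta> by (simp add: field_simps power2_eq_square)
  have da: "a + 2 * b * \<theta> = 2 * S * C" unfolding a_def b_def S_def[symmetric] C_def[symmetric]
    using \<theta> by (simp add: field_simps power2_eq_square)
  \<comment> \<open>Leads to \<open>b \<ge> cos (2 * \<theta>)\<close>: at \<theta> the parabola
    curves at least as much as the squared sine.\<close>
  have "S + C \<ge> 1"
  proof (rule power2_le_imp_le)
    show "1\<^sup>2 \<le> (S + C)\<^sup>2" using SC1 S0 C0 by (simp add: power2_sum)
  qed (use S0 C0 in auto)
  then have "S / \<theta> - C \<le> S" using q1 by linarith
  then have "(S / \<theta> - C)\<^sup>2 \<le> S\<^sup>2" using q1 by (intro power_mono) auto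
  moreover have "b = C\<^sup>2 - (S / \<theta> - C)\<^sup>2"
    unfolding b_def S_def[symmetric] C_def[symmetric] by (simp add: power2_eq_square algebra_simps)
  ultimately have b2: "b \<ge> cos (2 * \<theta>)" by (simp add: cos_double S_def C_def)
  show ?thesis
  proof (cases "t > \<theta>")
    case True
    define u where "u = t - \<theta>"
    have u: "u > 0" "t = \<theta> + u" using True by (auto simp: u_def)
    have su: "sin u * cos u < u"
      using sin_less_self[of "2*u"] u by (simp add: sin_double)
    have "(sin u)\<^sup>2 \<le> u\<^sup>2" using abs_sin_x_le_abs_x[of u] by (simp add: abs_le_square_iff)
    then have "cos (2 * \<theta>) * (sin u)\<^sup>2 \<le> b * u\<^sup>2"
      using b0 b2 by (smt (verit) mult_mono mult_nonneg_nonneg zero_le_power2 mult_nonpos_nonneg)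
    moreover have "sin (2*\<theta>) * (sin u * cos u) < sin (2*\<theta>) * u"
      using su \<theta> by (intro mult_strict_left_mono sin_gt_zero) auto
    moreover have "(sin t)\<^sup>2 = S\<^sup>2 + cos (2*\<theta>) * (sin u)\<^sup>2 + sin (2*\<theta>) * (sin u * cos u)"
    proof -
      have "(sin t)\<^sup>2 = (S * cos u + C * sin u)\<^sup>2" by (simp add: u sin_add S_def C_def)
      also have "\<dots> = S\<^sup>2 * (1 - (sin u)\<^sup>2) + C\<^sup>2 * (sin u)\<^sup>2 + 2 * S * C * (sin u * cos u)"
        unfolding cos_squared_eq[symmetric] by (simp add: power2_eq_square algebra_simps)
      also have "\<dots> = S\<^sup>2 + cos (2*\<theta>) * (sin u)\<^sup>2 + sin (2*\<theta>) * (sin u * cos u)"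
        unfolding cos_double sin_double S_def C_def by (simp add: algebra_simps)
      finally show ?thesis .
    qed
    moreover have "a * t + b * t\<^sup>2 = S\<^sup>2 + sin (2 * \<theta>) * u + b * u\<^sup>2"
    proof -
      have "a * t + b * t\<^sup>2 = (a * \<theta> + b * \<theta>\<^sup>2) + (a + 2 * b * \<theta>) * u + b * u\<^sup>2"
        by (simp add: u power2_eq_square algebra_simps)
      then show ?thesis by (simp add: a\<theta> da sin_double S_def C_def)
    qed
    ultimately show ?thesis by linarith
  next
    case False
    then have t\<theta>: "t < \<theta>" using t by auto
    \<comment> \<open>A Rolle count. \<open>p\<close> vanishes at 0 and doubly at \<theta>; a point
      \<open>t\<close> in between with \<open>p t \<le> 0\<close> makes \<open>p''\<close> first
      nonnegative and later nonpositive, although \<open>p''\<close> increases on this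
      interval.\<close>
    define p p' p'' where "p x = a * x + b * x\<^sup>2 - (sin x)\<^sup>2"
      and "p' x = a + 2 * b * x - sin (2 * x)" and "p'' x = 2 * b - 2 * cos (2 * x)" for x :: real
    have D1: "(p has_real_derivative p' x) (at x)" for x
      unfolding p_def p'_def sin_double by (auto intro!: derivative_eq_intros simp: power2_eq_square)
    have D2: "(p' has_real_derivative p'' x) (at x)" for x
      unfolding p''_def p'_def by (auto intro!: derivative_eq_intros)
    have p0: "p 0 = 0" "p \<theta> = 0" "p' \<theta> = 0"
      using a\<theta> da by (auto simp: p_def p'_def S_def C_def sin_double)
    show ?thesis
    proof (rule ccontr)
      assume "\<not> ?thesis"
      then have pt: "p t \<le> 0" by (simp add: p_def)
      obtain x1 where x1: "0 < x1" "x1 < t" "p t - p 0 = (t - 0) * p' x1"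
        using MVT2[of 0 t p p'] D1 t by auto
      obtain x2 where x2: "t < x2" "x2 < \<theta>" "p \<theta> - p t = (\<theta> - t) * p' x2"
        using MVT2[of t \<theta> p p'] D1 t\<theta> by auto
      have p1: "p' x1 \<le> 0" using x1 pt p0 t by (simp add: mult_le_0_iff)
      have p2: "p' x2 \<ge> 0" using x2 pt p0 t\<theta> by (smt (verit) mult_less_0_iff mult_pos_neg)
      obtain z1 where z1: "x1 < z1" "z1 < x2" "p' x2 - p' x1 = (x2 - x1) * p'' z1"
        using MVT2[of x1 x2 p' p''] D2 x1 x2 by auto
      obtain z2 where z2: "x2 < z2" "z2 < \<theta>" "p' \<theta> - p' x2 = (\<theta> - x2) * p'' z2"
        using MVT2[of x2 \<theta> p' p''] D2 x2 by auto
      have "p'' z1 \<ge> 0" using z1 p1 p2 x1 x2 by (smt (verit) mult_pos_neg)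
      moreover have "p'' z2 \<le> 0" using z2 p2 p0 by (smt (verit) mult_pos_pos)
      moreover have "cos (2 * z2) < cos (2 * z1)"
        by (rule cos_monotone_0_pi) (use z1 z2 x1 \<theta> in auto)
      ultimately show False by (simp add: p''_def)
    qed
  qed
qed
text \<open>The tangent bound is affine in \<open>x i\<close>, so with sum 1 it adds up to
  \<open>m * (pi * a) + pi\<^sup>2 * b\<close>. As the intercept \<open>pi * a\<close> is positive,
  \<open>m = n\<close> is the worst case; strictness of the tangent bound off \<open>1 / n\<close>
  settles equality.\<close>

lemma sum_sin_sq_div_le:
  fixes x :: "nat \<Rightarrow> real" and m n :: nat
  assumes n: "n \<ge> 3" and mn: "m \<le> n" and x: "\<And>i. i < m \<Longrightarrow> 0 < x i" and sum1: "(\<Sum>i<m. x i) = 1"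
  shows "(\<Sum>i<m. (sin (pi * x i))\<^sup>2 / x i) \<le> (real n * sin (pi / n))\<^sup>2"
    and "(\<Sum>i<m. (sin (pi * x i))\<^sup>2 / x i) = (real n * sin (pi / n))\<^sup>2
           \<Longrightarrow> m = n \<and> (\<forall>i<m. x i = 1 / n)"
proof -
  define \<theta> where "\<theta> = pi / n"
  have \<theta>: "0 < \<theta>" "\<theta> \<le> pi / 3" using n by (auto simp: \<theta>_def field_simps)
  define a where "a = 2 * sin \<theta> * (sin \<theta> / \<theta> - cos \<theta>)"
  define b where "b = sin \<theta> / \<theta> * (2 * cos \<theta> - sin \<theta> / \<theta>)"
  have "sin \<theta> > 0" using \<theta> by (intro sin_gt_zero) auto
  then have a0: "a > 0" using mult_cos_less_sin[of \<theta>] \<theta> by (auto simp: a_def field_simps)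
  define f where "f y = (sin (pi * y))\<^sup>2 / y" for y :: real
  have f_less: "f y < pi * a + pi\<^sup>2 * b * y" if "y > 0" "y \<noteq> 1 / n" for y
  proof -
    have "(sin (pi * y))\<^sup>2 < a * (pi * y) + b * (pi * y)\<^sup>2"
      unfolding a_def b_def using that n
      by (intro sin_sq_less_quadratic \<theta>) (auto simp: \<theta>_def field_simps)
    also have "\<dots> = (pi * a + pi\<^sup>2 * b * y) * y" by (simp add: power2_eq_square algebra_simps)
    finally show ?thesis using that by (simp add: f_def field_simps)
  qed
  have n\<theta>: "real n = pi / \<theta>" using n by (simp add: \<theta>_def)
  have f_eq: "f (1 / n) = pi * a + pi\<^sup>2 * b * (1 / n)"
  proof -
    have "a * \<theta> + b * \<theta>\<^sup>2 = (sin \<theta>)\<^sup>2" 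
      unfolding a_def b_def using \<theta> by (simp add: field_simps power2_eq_square)
    then have "(sin \<theta>)\<^sup>2 * (pi / \<theta>) = (a * \<theta> + b * \<theta>\<^sup>2) * (pi / \<theta>)" by simp
    also have "\<dots> = pi * a + pi * b * \<theta>" using \<theta> by (simp add: field_simps power2_eq_square)
    finally show ?thesis unfolding f_def n\<theta> using \<theta> by (simp add: field_simps power2_eq_square)
  qed
  have f_le: "f y \<le> pi * a + pi\<^sup>2 * b * y" if "y > 0" for y
    using f_less[of y] f_eq that by (cases "y = 1 / n") auto
  have tot: "(\<Sum>i<m. pi * a + pi\<^sup>2 * b * x i) = m * (pi * a) + pi\<^sup>2 * b"
    by (simp add: sum.distrib sum_distrib_left[symmetric] sum1)
  have R: "n * (pi * a) + pi\<^sup>2 * b = (real n * sin (pi / n))\<^sup>2"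
  proof -
    have "n * (pi * a) + pi\<^sup>2 * b = n * f (1 / n)"
      unfolding f_eq using n by (simp add: field_simps)
    also have "\<dots> = (real n * sin (pi / n))\<^sup>2" 
      using n by (simp add: f_def power2_eq_square field_simps)
    finally show ?thesis .
  qed
  have le1: "(\<Sum>i<m. f (x i)) \<le> m * (pi * a) + pi\<^sup>2 * b"
    unfolding tot[symmetric] by (intro sum_mono f_le x) auto
  have le2: "m * (pi * a) + pi\<^sup>2 * b \<le> n * (pi * a) + pi\<^sup>2 * b"
    using mn a0 by (intro add_right_mono mult_right_mono) auto
  show "(\<Sum>i<m. (sin (pi * x i))\<^sup>2 / x i) \<le> (real n * sin (pi / n))\<^sup>2"
    using le1 le2 unfolding R f_def by linarith
  assume "(\<Sum>i<m. (sin (pi * x i))\<^sup>2 / x i) = (real n * sin (pi / n))\<^sup>2"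
  then have eq: "(\<Sum>i<m. f (x i)) = n * (pi * a) + pi\<^sup>2 * b" unfolding R f_def .
  have "m * (pi * a) = n * (pi * a)" using eq le1 le2 by linarith
  then have "m = n" using a0 by simp
  moreover have "x i = 1 / n" if "i < m" for i
  proof (rule ccontr)
    assume "x i \<noteq> 1 / n"
    then have "(\<Sum>i<m. f (x i)) < (\<Sum>i<m. pi * a + pi\<^sup>2 * b * x i)"
      by (intro sum_strict_mono_ex1) (use that f_le f_less x in auto)
    then show False using eq tot \<open>m = n\<close> by simp
  qed
  ultimately show "m = n \<and> (\<forall>i<m. x i = 1 / n)" by blast
qed

section \<open>Minkowski's inequality for the mixed area form\<close>

definition cr :: "real^2 \<Rightarrow> real^2 \<Rightarrow> real" where
  "cr x y = x$1 * y$2 - x$2 * y$1"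

lemma cr_algebra:
  "cr (x + y) z = cr x z + cr y z" "cr x (y + z) = cr x y + cr x z"
  "cr (x - y) z = cr x z - cr y z" "cr x (y - z) = cr x y - cr x z"
  "cr (c *\<^sub>R x) z = c * cr x z" "cr x (c *\<^sub>R z) = c * cr x z"
  "cr (- x) z = - cr x z" "cr x (- z) = - cr x z"
  "cr x x = 0" "cr 0 x = 0" "cr x 0 = 0"
  by (auto simp: cr_def algebra_simps)

lemma cr_swap: "cr x y = - cr y x"
  by (simp add: cr_def)

lemma cr_sum_left: "cr (\<Sum>i\<in>A. f i) x = (\<Sum>i\<in>A. cr (f i) x)"
  by (induction A rule: infinite_finite_induct) (auto simp: cr_algebra)

lemma cr_plucker: "cr b c *\<^sub>R a + cr c a *\<^sub>R b + cr a b *\<^sub>R c = (0 :: real^2)"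
  by (simp add: vec_eq_iff forall_2 cr_def algebra_simps)

lemma sum_lessThan_telescope_periodic:
  fixes f :: "nat \<Rightarrow> 'a::ab_group_add"
  assumes "f m = f 0"
  shows "(\<Sum>i<m. f (Suc i) - f i) = 0"
  using assms by (simp add: sum_lessThan_telescope)

text \<open>The recursion says that the coordinates of \<^term>\<open>p\<close> are null vectors of the form \<^term>\<open>B\<close> below,
  which up to a negative factor is the mixed area of polygons with outer normals \<^term>\<open>p i\<close> as a function of their
  support numbers. Mind the shift: \<^term>\<open>dl i\<close> belongs to \<^term>\<open>p (Suc i)\<close>.\<close>
locale mixed_area_form =
  fixes m :: nat and p :: "nat \<Rightarrow> real^2" and dl :: "nat \<Rightarrow> real" and k :: nat
  assumes m_pos: "0 < m"
    and p_periodic: "p (i + m) = p i"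
    and dl_periodic: "dl (i + m) = dl i"
    and dl_pos: "dl i > 0"
    and d_pos: "cr (p i) (p (Suc i)) > 0"
    and recursion: "(1 / cr (p i) (p (Suc i))) *\<^sub>R (p (Suc i) - p i)
        - (1 / cr (p (Suc i)) (p (Suc (Suc i)))) *\<^sub>R (p (Suc (Suc i)) - p (Suc i))
        = dl i *\<^sub>R p (Suc i)"
    and u_pos: "0 < i \<Longrightarrow> i \<le> k \<Longrightarrow> cr (p 0) (p i) > 0"
    and u_neg: "Suc k < i \<Longrightarrow> i < m \<Longrightarrow> cr (p 0) (p i) < 0"
    and u_le: "cr (p 0) (p (Suc k)) \<le> 0"
    and k_pos: "0 < k" and k_less: "Suc k < m"
begin

definition d :: "nat \<Rightarrow> real" where "d i = cr (p i) (p (Suc i))"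

definition B :: "(nat \<Rightarrow> real) \<Rightarrow> (nat \<Rightarrow> real) \<Rightarrow> real" where
  "B x y = (\<Sum>i<m. (x (Suc i) - x i) * (y (Suc i) - y i) / d i - dl i * x (Suc i) * y (Suc i))"

text \<open>Represents the form: \<open>B_by_parts\<close> pairs entry \<open>i\<close> with
  \<open>y (Suc i)\<close>, which avoids predecessor indices. Zero defect is the recursion of the
  locale, read for scalars.\<close>

definition defect :: "(nat \<Rightarrow> real) \<Rightarrow> nat \<Rightarrow> real" where
  "defect x i = (x (Suc i) - x i) / d i - (x (Suc (Suc i)) - x (Suc i)) / d (Suc i) - dl i * x (Suc i)"

lemma d_pos': "d i > 0"
  using d_pos by (simp add: d_def)

lemma d_periodic: "d (i + m) = d i"
  using p_periodic[of i] p_periodic[of "Suc i"] by (simp add: d_def)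

lemma B_commute: "B x y = B y x"
  by (simp add: B_def mult_ac)

lemma B_add: "B (\<lambda>i. x i + y i) z = B x z + B y z"
  by (simp add: B_def sum.distrib[symmetric] add_divide_distrib[symmetric] algebra_simps sum_subtractf[symmetric])

lemma B_scale: "B (\<lambda>i. c * x i) z = c * B x z"
  unfolding B_def sum_distrib_left
  by (intro sum.cong refl) (simp add: algebra_simps diff_divide_distrib)

lemma B_by_parts:
  assumes "\<And>i. x (i + m) = x i" "\<And>i. y (i + m) = y i"
  shows "B x y = (\<Sum>i<m. defect x i * y (Suc i))"
proof -
  define W where "W i = y i * (x (Suc i) - x i) / d i" for i
  have "B x y - (\<Sum>i<m. defect x i * y (Suc i)) = (\<Sum>i<m. W (Suc i) - W i)"
    unfolding B_def sum_subtractf[symmetric]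
    by (intro sum.cong refl)
      (simp add: W_def defect_def algebra_simps diff_divide_distrib add_divide_distrib)
  also have "\<dots> = 0"
    using assms[of 0] assms[of 1] d_periodic[of 0]
    by (intro sum_lessThan_telescope_periodic) (simp add: W_def)
  finally show ?thesis by simp
qed

lemma defect_inner: "defect (\<lambda>i. t \<bullet> p i) i = 0"
  using arg_cong[OF recursion[of i], of "\<lambda>x. t \<bullet> x"]
  by (simp add: defect_def d_def inner_diff_right diff_divide_distrib)

lemma B_inner_left:
  assumes "\<And>i. y (i + m) = y i"
  shows "B (\<lambda>i. t \<bullet> p i) y = 0"
  using assms by (simp add: B_by_parts p_periodic defect_inner)

lemma B_const_left: "B (\<lambda>i. c) y = - c * (\<Sum>i<m. dl i * y (Suc i))"
  by (simp add: B_def sum_negf sum_distrib_left mult_ac)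

lemma sum_dl_pos: "(\<Sum>i<m. dl i) > 0"
  using m_pos dl_pos by (intro sum_pos) auto

text \<open>Picone's identity for the null vector \<^term>\<open>\<lambda>i. cr (p 0) (p i)\<close>, which is positive on one
  arc and negative on the complementary one: when \<^term>\<open>x\<close> vanishes where it does, all the squares
  that remain have nonnegative coefficients.\<close>
lemma B_nonneg_if_common_zeros:
  assumes per: "\<And>i. x (i + m) = x i"
    and x0: "x 0 = 0"
    and xk: "x k * cr (p 0) (p (Suc k)) = x (Suc k) * cr (p 0) (p k)"
  shows "B x x \<ge> 0"
proof -
  define u where "u i = cr (p 0) (p i)" for i
  define q where "q i = (u (Suc i) - u i) / d i" for i
  \<comment> \<open>Picone's boundary term. Division by zero yields 0, so \<open>W i = 0\<close>
    where \<open>u i = 0\<close>; since \<open>x i = 0\<close> there too, the increments stay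
    correct in the first three cases below.\<close>
  define W where "W i = (x i)\<^sup>2 * q i / u i" for i
  have u_rot: "u i = vector [- p 0 $ 2, p 0 $ 1] \<bullet> p i" for i
    by (simp add: u_def cr_def inner_vec_def sum_2)
  have q_Suc: "q (Suc i) = q i - dl i * u (Suc i)" for i
    using defect_inner[of "vector [- p 0 $ 2, p 0 $ 1]" i]
    by (simp add: defect_def q_def u_rot)
  have uk: "u k > 0" using u_pos[of k] k_pos by (simp add: u_def)
  have u0: "u i = 0 \<Longrightarrow> i \<le> m \<Longrightarrow> x i = 0" for i
  proof -
    assume *: "u i = 0" "i \<le> m"
    then have "i = 0 \<or> i = Suc k \<or> i = m"
      using u_pos[of i] u_neg[of i] unfolding u_def
      by (metis Suc_lessI le_neq_implies_less less_irrefl neq0_conv not_le_imp_less)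
    moreover have "x (Suc k) = 0" if "u (Suc k) = 0"
      using xk uk that by (simp add: u_def)
    ultimately show "x i = 0" using x0 per[of 0] * by auto
  qed
  have step: "W (Suc i) - W i \<le> (x (Suc i) - x i) * (x (Suc i) - x i) / d i - dl i * x (Suc i) * x (Suc i)"
    if i: "i < m" for i
  proof -
    have d: "d i > 0" by (rule d_pos')
    consider "u i = 0" "u (Suc i) = 0" | "u i = 0" "u (Suc i) \<noteq> 0" | "u i \<noteq> 0" "u (Suc i) = 0"
      | "u i \<noteq> 0" "u (Suc i) \<noteq> 0" by blast
    then show ?thesis
    proof cases
      case 1
      then show ?thesis using u0[of i] u0[of "Suc i"] i by (simp add: W_def)
    next
      case 2
      then show ?thesis using u0[of i] i d
        by (simp add: W_def q_Suc) (simp add: q_def field_simps power2_eq_square)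
    next
      case 3
      then show ?thesis using u0[of "Suc i"] i d
        by (simp add: W_def) (simp add: q_def field_simps power2_eq_square)
    next
      case 4
      define R where "R = u i * u (Suc i) / d i * (x i / u i - x (Suc i) / u (Suc i))\<^sup>2"
      have "R \<ge> 0"
      proof (cases "u i * u (Suc i) > 0")
        case True
        then show ?thesis using d by (simp add: R_def)
      next
        case False
        \<comment> \<open>\<open>u\<close> is positive at 1, ..., \<open>k\<close>, negative
          strictly between \<open>Suc k\<close> and \<open>m\<close>, and zero at 0 and
          \<open>m\<close>; so neighbouring values have opposite signs at most across
          \<open>k\<close>. There \<open>xk\<close> makes the square itself vanish.\<close>
        have "i = k"
        proof (rule ccontr)
          assume "i \<noteq> k"
          then consider "i = 0" | "0 < i" "i < k" | "i = Suc k" | "Suc k < i" "Suc i = m" | "Suc k < i" "Suc i < m"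
            using i by linarith
          then show False
          proof cases
            case 3
            then have "u (Suc k) < 0" using 4 u_le by (simp add: u_def)
            moreover have "u (Suc (Suc k)) < 0" 
              using 4 3 u_neg[of "Suc (Suc k)"] i p_periodic[of 0]
              by (cases "Suc i = m") (auto simp: u_def cr_algebra)
            ultimately show False using False 3 by (simp add: mult_neg_neg)
          qed (use 4 False u_pos[of i] u_pos[of "Suc i"] u_neg[of i] u_neg[of "Suc i"] p_periodic[of 0]
              in \<open>auto simp: u_def cr_algebra mult_neg_neg\<close>)
        qed
        then have "x i / u i = x (Suc i) / u (Suc i)" using xk 4 by (simp add: u_def field_simps)
        then show ?thesis by (simp add: R_def)
      qed
      moreover have "(x (Suc i) - x i) * (x (Suc i) - x i) / d i - dl i * x (Suc i) * x (Suc i) 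
          = W (Suc i) - W i + R"
      proof -
        have "W (Suc i) = (x (Suc i))\<^sup>2 * q i / u (Suc i) - dl i * x (Suc i) * x (Suc i)"
          using 4 by (simp add: W_def q_Suc field_simps power2_eq_square)
        moreover have "(x (Suc i) - x i) * (x (Suc i) - x i) / d i = (x (Suc i))\<^sup>2 * q i / u (Suc i) - (x i)\<^sup>2 * q i / u i + R"
          using 4 d by (simp add: R_def q_def divide_simps) (simp add: power2_eq_square algebra_simps)
        ultimately show ?thesis by (simp add: W_def)
      qed
      ultimately show ?thesis by linarith
    qed
  qed
  have "W m = W 0" using per[of 0] x0 by (simp add: W_def)
  then have "0 = (\<Sum>i<m. W (Suc i) - W i)" by (simp add: sum_lessThan_telescope)
  also have "\<dots> \<le> B x x" unfolding B_def by (intro sum_mono step) auto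
  finally show ?thesis .
qed

text \<open>Minkowski's inequality for mixed areas: \<^term>\<open>B\<close> is nonnegative on the complement of the
  constants. Adding a constant only decreases \<^term>\<open>B y y\<close>, and subtracting a null vector
  does not change it; together they produce the common zeros.\<close>
theorem B_nonneg:
  assumes per: "\<And>i. y (i + m) = y i" and bal: "(\<Sum>i<m. dl i * y (Suc i)) = 0"
  shows "B y y \<ge> 0"
proof -
  define u where "u i = cr (p 0) (p i)" for i
  \<comment> \<open>Together with \<open>x 0 = 0\<close>, the equation
    \<open>\<Lambda> x = 0\<close> is the second condition on common zeros. The term in
    \<open>x 0\<close> makes \<open>\<Lambda>\<close> vanish on the null vectors, by the Pluecker
    relation; so \<open>c\<close> can be fixed by \<open>\<Lambda>\<close> first and
    \<open>t\<close> by \<open>x 0\<close> afterwards.\<close>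
  define \<Lambda> where "\<Lambda> x = x k * u (Suc k) - x (Suc k) * u k - d k * x 0" for x :: "nat \<Rightarrow> real"
  have p0: "p 0 \<noteq> 0" using d_pos[of 0] by (auto simp: cr_algebra)
  have \<Lambda>1: "\<Lambda> (\<lambda>i. 1) < 0"
    using u_le u_pos[of k] k_pos d_pos'[of k] by (simp add: \<Lambda>_def u_def)
  define c where "c = - \<Lambda> y / \<Lambda> (\<lambda>i. 1)"
  define t where "t = (- (y 0 + c) / (p 0 \<bullet> p 0)) *\<^sub>R p 0"
  define x where "x i = y i + (c + t \<bullet> p i)" for i
  have x_per: "x (i + m) = x i" for i by (simp add: x_def per p_periodic)
  have x0: "x 0 = 0" using p0 by (simp add: x_def t_def)
  have "\<Lambda> (\<lambda>i. t \<bullet> p i) = t \<bullet> (u (Suc k) *\<^sub>R p k - u k *\<^sub>R p (Suc k) - d k *\<^sub>R p 0)"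
    by (simp add: \<Lambda>_def inner_diff_right)
  also have "u (Suc k) *\<^sub>R p k - u k *\<^sub>R p (Suc k) - d k *\<^sub>R p 0 = 0"
    using cr_plucker[of "p k" "p (Suc k)" "p 0"] 
    by (simp add: u_def d_def cr_swap[of "p (Suc k)" "p 0"] algebra_simps) 
  finally have \<Lambda>t: "\<Lambda> (\<lambda>i. t \<bullet> p i) = 0" by simp
  have "\<Lambda> x = \<Lambda> y + c * \<Lambda> (\<lambda>i. 1) + \<Lambda> (\<lambda>i. t \<bullet> p i)"
    by (simp add: \<Lambda>_def x_def algebra_simps)
  also have "\<dots> = 0" using \<Lambda>1 \<Lambda>t by (simp add: c_def)
  finally have "B x x \<ge> 0"
    by (intro B_nonneg_if_common_zeros x_per x0) (auto simp: \<Lambda>_def u_def x0)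
  also have "B x x = B y y + 2 * B (\<lambda>i. c) y + B (\<lambda>i. c) (\<lambda>i. c)"
  proof -
    have e: "B x w = B y w + B (\<lambda>i. c) w" if "\<And>i. w (i + m) = w i" for w
      using that B_add[of y "\<lambda>i. c + t \<bullet> p i" w] B_add[of "\<lambda>i. c" "\<lambda>i. t \<bullet> p i" w]
      by (simp add: x_def[abs_def] B_inner_left)
    show ?thesis
      using e[of x, OF x_per] e[of "\<lambda>i. c", OF refl] e[of y, OF per] B_commute[of y x] B_commute[of "\<lambda>i. c" x]
        B_commute[of "\<lambda>i. c" y] by linarith
  qed
  also have "\<dots> = B y y - c\<^sup>2 * (\<Sum>i<m. dl i)"
    by (simp add: B_const_left bal sum_distrib_right[symmetric] power2_eq_square)
  also have "\<dots> \<le> B y y" using sum_dl_pos by simp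
  finally show ?thesis .
qed

text \<open>\<open>y\<close> minimizes the form on the complement of the constants, so the first
  variation vanishes there. By \<open>bal\<close> it vanishes on constants as well, and testing
  against the defect itself makes a sum of squares zero.\<close>

theorem B_eq_0_imp_defect_eq_0:
  assumes per: "\<And>i. y (i + m) = y i" and bal: "(\<Sum>i<m. dl i * y (Suc i)) = 0" and B0: "B y y = 0"
  shows "defect y i = 0"
proof -
  have lin: "B y h = 0" if h: "\<And>i. h (i + m) = h i" "(\<Sum>i<m. dl i * h (Suc i)) = 0" for h
  proof -
    have *: "0 \<le> 2 * s * B y h + s\<^sup>2 * B h h" for s
    proof -
      have "0 \<le> B (\<lambda>i. y i + s * h i) (\<lambda>i. y i + s * h i)"
      proof (rule B_nonneg)
        have "(\<Sum>i<m. dl i * (y (Suc i) + s * h (Suc i)))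
            = (\<Sum>i<m. dl i * y (Suc i)) + s * (\<Sum>i<m. dl i * h (Suc i))"
          by (simp add: algebra_simps sum.distrib sum_distrib_left)
        then show "(\<Sum>i<m. dl i * (y (Suc i) + s * h (Suc i))) = 0" using bal h by simp
      qed (simp add: per h)
      also have "\<dots> = 2 * s * B y h + s\<^sup>2 * B h h"
        using B0 by (simp add: B_add B_scale B_commute[of _ "\<lambda>i. y i + s * h i"])
          (simp add: B_commute[of h y] power2_eq_square algebra_simps)
      finally show ?thesis .
    qed
    show ?thesis
    proof (rule ccontr)
      assume nz: "B y h \<noteq> 0"
      \<comment> \<open>Minimizes the majorant
        \<open>2 * s * B y h + s\<^sup>2 * (\<bar>B h h\<bar> + 1)\<close>; the added 1 keeps the
        denominator positive.\<close>
      define s where "s = - B y h / (\<bar>B h h\<bar> + 1)"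
      have "2 * s * B y h + s\<^sup>2 * B h h \<le> 2 * s * B y h + s\<^sup>2 * (\<bar>B h h\<bar> + 1)"
        by (intro add_left_mono mult_left_mono) auto
      also have "\<dots> = - (B y h)\<^sup>2 / (\<bar>B h h\<bar> + 1)"
      proof -
        have "s * (\<bar>B h h\<bar> + 1) = - B y h" by (simp add: s_def)
        then have "s\<^sup>2 * (\<bar>B h h\<bar> + 1) = - s * B y h" by (simp add: power2_eq_square mult.assoc)
        then have "2 * s * B y h + s\<^sup>2 * (\<bar>B h h\<bar> + 1) = s * B y h" by simp
        then show ?thesis by (simp add: s_def power2_eq_square)
      qed
      also have "\<dots> < 0" using nz by (simp add: divide_less_0_iff) 
      finally show False using *[of s] by linarith
    qed
  qed
  have lin': "B y h = 0" if h: "\<And>i. h (i + m) = h i" for h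
  proof -
    define c where "c = (\<Sum>i<m. dl i * h (Suc i)) / (\<Sum>i<m. dl i)"
    have "B y (\<lambda>i. h i + (- c)) = 0"
    proof (rule lin)
      have "(\<Sum>i<m. dl i * (h (Suc i) + (- c))) = (\<Sum>i<m. dl i * h (Suc i)) - c * (\<Sum>i<m. dl i)"
        by (simp add: algebra_simps sum_subtractf sum_distrib_left)
      also have "\<dots> = 0" using sum_dl_pos by (simp add: c_def)
      finally show "(\<Sum>i<m. dl i * (h (Suc i) + (- c))) = 0" .
    qed (simp add: h)
    then show ?thesis using B_const_left[of "- c" y] B_add[of h "\<lambda>i. - c" y] bal
      by (simp add: B_commute[of y])
  qed
  \<comment> \<open>\<open>j + m - 1\<close> is the cyclic predecessor of \<open>j\<close>, which
    undoes the shift in \<open>B_by_parts\<close>.\<close>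
  define h where "h j = defect y (j + m - 1)" for j
  have defect_per: "defect y (j + m) = defect y j" for j
    using per[of j] per[of "Suc j"] per[of "Suc (Suc j)"] d_periodic[of j] d_periodic[of "Suc j"] dl_periodic[of j]
    by (simp add: defect_def)
  have h_Suc: "h (Suc j) = defect y j" for j
    by (simp add: h_def defect_per)
  have h_per: "h (j + m) = h j" for j
    using defect_per[of "j + m - 1"] m_pos by (simp add: h_def add_ac)
  have "(\<Sum>i<m. (defect y i)\<^sup>2) = 0"
    using B_by_parts[of y h] lin'[of h] h_per per by (simp add: h_Suc power2_eq_square)
  then have z: "defect y i = 0" if "i < m" for i
    using that by (simp add: sum_nonneg_eq_0_iff)
  have "defect y (j + r * m) = defect y j" for r j
  proof (induction r)
    case (Suc r)
    then show ?case using defect_per[of "j + r * m"] by (simp add: add_ac)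
  qed simp
  from this[of "i mod m" "i div m"] show ?thesis using z[of "i mod m"] m_pos by (simp add: mod_div_mult_eq)
qed

end

section \<open>Convex polygons and their polars\<close>

lemma cr_eq_inner: "cr a x = vector [- a $ 2, a $ 1] \<bullet> x"
  by (simp add: cr_def inner_vec_def sum_2)

lemma negligible_cr_eq_0:
  assumes "a \<noteq> 0"
  shows "negligible {x. cr a x = 0}"
proof -
  have "vector [- a $ 2, a $ 1] \<noteq> (0 :: real^2)"
    using assms by (auto simp: vec_eq_iff forall_2)
  then show ?thesis unfolding cr_eq_inner by (intro negligible_hyperplane) auto
qed

lemma cr_coordinates:
  assumes "cr a b \<noteq> 0"
  shows "x = (cr x b / cr a b) *\<^sub>R a + (cr a x / cr a b) *\<^sub>R b"
proof -
  have "cr a b *\<^sub>R x = cr x b *\<^sub>R a + cr a x *\<^sub>R b"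
    by (simp add: vec_eq_iff forall_2 cr_def algebra_simps)
  then have "(1 / cr a b) *\<^sub>R (cr a b *\<^sub>R x) = (1 / cr a b) *\<^sub>R (cr x b *\<^sub>R a + cr a x *\<^sub>R b)" by simp
  then show ?thesis using assms by (simp add: scaleR_add_right)
qed

lemma convex_hull_0_2:
  fixes a b :: "'a::real_vector"
  shows "convex hull {0, a, b} = {s *\<^sub>R a + t *\<^sub>R b | s t. 0 \<le> s \<and> 0 \<le> t \<and> s + t \<le> 1}"
proof (intro equalityI subsetI)
  fix x assume "x \<in> convex hull {0, a, b}"
  then obtain u s t where "0 \<le> u" "0 \<le> s" "0 \<le> t" "u + s + t = 1" "x = s *\<^sub>R a + t *\<^sub>R b"
    by (auto simp: convex_hull_3)
  then show "x \<in> {s *\<^sub>R a + t *\<^sub>R b | s t. 0 \<le> s \<and> 0 \<le> t \<and> s + t \<le> 1}" by force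
next
  fix x assume "x \<in> {s *\<^sub>R a + t *\<^sub>R b | s t. 0 \<le> s \<and> 0 \<le> t \<and> s + t \<le> 1}"
  then obtain s t where st: "x = s *\<^sub>R a + t *\<^sub>R b" "0 \<le> s" "0 \<le> t" "s + t \<le> 1" by auto
  then have "x = (1 - s - t) *\<^sub>R 0 + s *\<^sub>R a + t *\<^sub>R b" "0 \<le> 1 - s - t" "(1 - s - t) + s + t = 1" by auto
  then show "x \<in> convex hull {0, a, b}" unfolding convex_hull_3 using st by blast
qed

text \<open>The hypotheses are symmetric under exchanging \<^term>\<open>v\<close> and \<^term>\<open>w\<close> up to an index shift, so
  that this computes the area of a polygon as well as that of its polar.\<close>
lemma fan_decomposition:
  fixes v w :: "nat \<Rightarrow> real^2"
  assumes m: "0 < m" and closed: "v m = v 0"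
    and d: "\<And>i. i < m \<Longrightarrow> cr (v i) (v (Suc i)) > 0"
    and w1: "\<And>i. i < m \<Longrightarrow> w i \<bullet> v i = 1" and w2: "\<And>i. i < m \<Longrightarrow> w i \<bullet> v (Suc i) = 1"
    and le: "\<And>i j. i < m \<Longrightarrow> j < m \<Longrightarrow> w i \<bullet> v j \<le> 1"
    and uniq: "\<And>i j. i < m \<Longrightarrow> j < m \<Longrightarrow> w i \<bullet> v j = 1 \<Longrightarrow> w i \<bullet> v (Suc j) = 1 \<Longrightarrow> i = j"
    and c: "\<And>i. i < m \<Longrightarrow> c i > 0" and bal: "(\<Sum>i<m. c i *\<^sub>R v i) = 0"
  shows "{x. \<forall>i<m. w i \<bullet> x \<le> 1} = (\<Union>i<m. convex hull {0, v i, v (Suc i)})"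
    and "area {x. \<forall>i<m. w i \<bullet> x \<le> 1} = (\<Sum>i<m. cr (v i) (v (Suc i))) / 2"
proof -
  define T where "T i = convex hull {0, v i, v (Suc i)}" for i
  have le': "w i \<bullet> v j \<le> 1" if "i < m" "j \<le> m" for i j
    using that le[of i j] le[of i 0] closed m by (cases "j = m") auto
  \<comment> \<open>Were \<open>x\<close> in no cone, a nonnegative \<open>cr (v i) x\<close> would
    force a positive one at the next index, hence at all indices once around; but by
    \<open>bal\<close> a positive combination of these numbers is zero.\<close>
  have cover: "\<exists>i<m. cr (v i) x \<ge> 0 \<and> cr (v (Suc i)) x \<le> 0" for x
  proof (rule ccontr)
    assume "\<not> ?thesis"
    then have step: "cr (v (Suc i)) x > 0" if "i < m" "cr (v i) x \<ge> 0" for i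
      using that by force
    have s0: "(\<Sum>i<m. c i * cr (v i) x) = 0"
      using arg_cong[OF bal, of "\<lambda>y. cr y x"] by (simp add: cr_sum_left cr_algebra)
    have "\<exists>i<m. cr (v i) x \<ge> 0"
    proof (rule ccontr)
      assume "\<not> ?thesis"
      then have "(\<Sum>i<m. c i * cr (v i) x) < (\<Sum>i<m. 0)"
        using c m by (intro sum_strict_mono) (auto simp: mult_pos_neg not_le)
      then show False using s0 by simp
    qed
    then obtain i0 where i0: "i0 < m" "cr (v i0) x \<ge> 0" by blast
    have up: "cr (v j) x > 0" if "Suc i \<le> j" "j \<le> m" "cr (v i) x \<ge> 0" for i j
      using that
    proof (induction j rule: dec_induct)
      case base then show ?case using step[of i] by simp
    next
      case (step n) then show ?case using \<open>\<And>i. i < m \<Longrightarrow> 0 \<le> cr (v i) x \<Longrightarrow> 0 < cr (v (Suc i)) x\<close>[of n] by simp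
    qed
    have v0: "cr (v 0) x > 0" using up[of i0 m] i0 closed by simp
    have "cr (v i) x > 0" if "i < m" for i
      using up[of 0 i] v0 that by (cases "i = 0") auto
    then have "(\<Sum>i<m. c i * cr (v i) x) > 0" using c m by (intro sum_pos) auto
    then show False using s0 by simp
  qed
  show dec: "{x. \<forall>i<m. w i \<bullet> x \<le> 1} = (\<Union>i<m. convex hull {0, v i, v (Suc i)})"
  proof (intro equalityI subsetI)
    fix x assume "x \<in> {x. \<forall>i<m. w i \<bullet> x \<le> 1}"
    then have x: "\<And>i. i < m \<Longrightarrow> w i \<bullet> x \<le> 1" by blast
    obtain i where i: "i < m" "cr (v i) x \<ge> 0" "cr (v (Suc i)) x \<le> 0" using cover by blast
    define s t where "s = cr x (v (Suc i)) / cr (v i) (v (Suc i))" and "t = cr (v i) x / cr (v i) (v (Suc i))"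
    have st: "x = s *\<^sub>R v i + t *\<^sub>R v (Suc i)" "s \<ge> 0" "t \<ge> 0"
      using cr_coordinates[of "v i" "v (Suc i)" x] d[of i] i cr_swap[of x "v (Suc i)"]
      by (auto simp: s_def t_def intro: divide_nonpos_pos)
    have "s + t = w i \<bullet> x" unfolding st(1) using w1 w2 i by (simp add: inner_add_right)
    then show "x \<in> (\<Union>i<m. convex hull {0, v i, v (Suc i)})"
      using st x[of i] i unfolding convex_hull_0_2 by force
  next
    fix x assume "x \<in> (\<Union>i<m. convex hull {0, v i, v (Suc i)})"
    then obtain i s t where i: "i < m" and st: "x = s *\<^sub>R v i + t *\<^sub>R v (Suc i)" "0 \<le> s" "0 \<le> t" "s + t \<le> 1"
      unfolding convex_hull_0_2 by auto
    have "w j \<bullet> x \<le> 1" if "j < m" for j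
    proof -
      have "w j \<bullet> x \<le> s * 1 + t * 1" 
        unfolding st(1) inner_add_right inner_scaleR_right
        using le'[of j i] le'[of j "Suc i"] i st that by (intro add_mono mult_left_mono) auto
      then show ?thesis using st by simp
    qed
    then show "x \<in> {x. \<forall>i<m. w i \<bullet> x \<le> 1}" by blast
  qed
  have neg: "negligible (T i \<inter> T j)" if ij: "i < m" "j < m" "i \<noteq> j" for i j
  proof (rule negligible_subset)
    have nz: "v l \<noteq> 0" "v (Suc l) \<noteq> 0" if "l < m" for l using d[of l] that by (auto simp: cr_algebra)
    show "negligible ({x. cr (v i) x = 0} \<union> {x. cr (v (Suc i)) x = 0} \<union> {x. cr (v j) x = 0} \<union> {x. cr (v (Suc j)) x = 0})"
      using nz ij by (intro negligible_Un negligible_cr_eq_0) auto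
    show "T i \<inter> T j \<subseteq> ({x. cr (v i) x = 0} \<union> {x. cr (v (Suc i)) x = 0} \<union> {x. cr (v j) x = 0} \<union> {x. cr (v (Suc j)) x = 0})"
    proof (rule ccontr)
      assume "\<not> ?thesis"
      then obtain x where x: "x \<in> T i" "x \<in> T j" "cr (v i) x \<noteq> 0" "cr (v (Suc i)) x \<noteq> 0" "cr (v j) x \<noteq> 0" "cr (v (Suc j)) x \<noteq> 0"
        by auto
      obtain s t where st: "x = s *\<^sub>R v i + t *\<^sub>R v (Suc i)" "0 \<le> s" "0 \<le> t"
        using x(1) unfolding T_def convex_hull_0_2 by auto
      obtain s' t' where st': "x = s' *\<^sub>R v j + t' *\<^sub>R v (Suc j)" "0 \<le> s'" "0 \<le> t'"
        using x(2) unfolding T_def convex_hull_0_2 by auto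
      have "s \<noteq> 0" "t \<noteq> 0" using x(3,4) unfolding st(1) by (auto simp: cr_algebra)
      moreover have "s' \<noteq> 0" "t' \<noteq> 0" using x(5,6) unfolding st'(1) by (auto simp: cr_algebra)
      ultimately have pos: "s > 0" "t > 0" "s' > 0" "t' > 0" using st st' by auto
      \<comment> \<open>Evaluating \<open>w i\<close> and \<open>w j\<close> at a point inside both
        cones gives \<open>s + t \<le> s' + t'\<close> and the converse; equality means that
        \<open>w i\<close> is 1 at both ends of edge \<open>j\<close>.\<close>
      have 1: "w i \<bullet> x = s + t" unfolding st(1) using w1 w2 ij by (simp add: inner_add_right)
      have 2: "w j \<bullet> x = s' + t'" unfolding st'(1) using w1 w2 ij by (simp add: inner_add_right)
      have 3: "w j \<bullet> x \<le> s * 1 + t * 1" unfolding st(1) inner_add_right inner_scaleR_right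
        using le'[of j i] le'[of j "Suc i"] ij pos by (intro add_mono mult_left_mono) auto
      have 4: "w i \<bullet> v j = 1 \<and> w i \<bullet> v (Suc j) = 1"
      proof (rule ccontr)
        assume a: "\<not> ?thesis"
        have "w i \<bullet> v j \<le> 1" "w i \<bullet> v (Suc j) \<le> 1" using le'[of i j] le'[of i "Suc j"] ij by auto
        then have "s' * (1 - w i \<bullet> v j) \<ge> 0" "t' * (1 - w i \<bullet> v (Suc j)) \<ge> 0"
          "s' * (1 - w i \<bullet> v j) > 0 \<or> t' * (1 - w i \<bullet> v (Suc j)) > 0"
          using a pos by (auto simp: less_le)
        moreover have "w i \<bullet> x = s' * (w i \<bullet> v j) + t' * (w i \<bullet> v (Suc j))"
          unfolding st'(1) by (simp add: inner_add_right)
        ultimately have "w i \<bullet> x < s' + t'" by (auto simp: algebra_simps)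
        then show False using 1 2 3 by simp
      qed
      show False using uniq[OF ij(1,2)] 4 ij by blast
    qed
  qed
  have meas: "measure lebesgue (T i) = cr (v i) (v (Suc i)) / 2" if "i < m" for i
  proof -
    have "T i \<in> sets borel" unfolding T_def by (intro borel_compact compact_convex_hull) simp
    then have "measure lebesgue (T i) = measure lborel (T i)" by simp
    then show ?thesis
      using content_triangle[of 0 "v i" "v (Suc i)"] d[OF that] by (simp add: T_def cr_def mult.commute)
  qed
  have "area (\<Union>(T ` {..<m})) = (\<Sum>i<m. measure lebesgue (T i))"
  proof (rule measure_negligible_finite_Union_image)
    show "T i \<in> lmeasurable" for i unfolding T_def 
      by (intro lmeasurable_compact compact_convex_hull) simp
  qed (use neg in \<open>auto simp: pairwise_def\<close>)
  also have "\<dots> = (\<Sum>i<m. cr (v i) (v (Suc i))) / 2"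
    unfolding sum_divide_distrib by (intro sum.cong refl meas) simp
  finally show "area {x. \<forall>i<m. w i \<bullet> x \<le> 1} = (\<Sum>i<m. cr (v i) (v (Suc i))) / 2"
    unfolding dec T_def .
qed

section \<open>Strictly convex polygons with cyclically numbered vertices\<close>

definition orient :: "real^2 \<Rightarrow> real^2 \<Rightarrow> real^2 \<Rightarrow> real" where
  "orient x y z = cr (y - x) (z - x)"

lemma orient_rotate: "orient x y z = orient y z x"
  by (simp add: orient_def cr_def algebra_simps)

lemma orient_eq_inner:
  "orient x y z = cr x y + vector [x $ 2 - y $ 2, y $ 1 - x $ 1] \<bullet> z"
  by (simp add: orient_def cr_def inner_vec_def sum_2 algebra_simps)

lemma orient_degenerate [simp]: "orient x y x = 0" "orient x y y = 0" "orient x x y = 0"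
  by (auto simp: orient_def cr_algebra)

lemma sum_lessThan_shift_periodic:
  fixes f :: "nat \<Rightarrow> 'a::ab_group_add"
  assumes "f m = f 0"
  shows "(\<Sum>i<m. f (Suc i)) = (\<Sum>i<m. f i)"
  using sum_lessThan_telescope_periodic[of f m] assms by (simp add: sum_subtractf)

text \<open>Numbering by all naturals with period \<open>m\<close> makes \<open>Suc\<close> the
  cyclic successor. Left turns are required of all ordered triples: consecutive ones alone would
  admit star polygons.\<close>

locale ccw_polygon =
  fixes m :: nat and v :: "nat \<Rightarrow> real^2"
  assumes m_ge_3: "m \<ge> 3"
    and periodic: "v (i + m) = v i"
    and ccw: "i < j \<Longrightarrow> j < l \<Longrightarrow> l < m \<Longrightarrow> orient (v i) (v j) (v l) > 0"
begin

definition K :: "(real^2) set" where "K = convex hull (v ` {..<m})"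

text \<open>The number d_i of the overview as a function of the point; it is affine in
  \<open>z\<close>.\<close>

definition e :: "nat \<Rightarrow> real^2 \<Rightarrow> real" where "e i z = orient (v i) (v (Suc i)) z"

definition a :: "nat \<Rightarrow> real" where "a i = orient (v i) (v (Suc i)) (v (Suc (Suc i)))"

definition Z :: "(real^2) set" where "Z = {z. \<forall>i. e i z > 0}"

text \<open>The vertices of the polar of \<^term>\<open>K\<close> with respect to \<^term>\<open>z\<close>.\<close>
definition w :: "real^2 \<Rightarrow> nat \<Rightarrow> real^2" where
  "w z i = (1 / e i z) *\<^sub>R vector [v (Suc i) $ 2 - v i $ 2, v i $ 1 - v (Suc i) $ 1]"

text \<open>Vertex \<^term>\<open>l\<close> is an endpoint of edge \<^term>\<open>i\<close>.\<close>
definition near :: "nat \<Rightarrow> nat \<Rightarrow> bool" where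
  "near l i \<longleftrightarrow> l mod m = i mod m \<or> l mod m = Suc i mod m"

lemma m_pos: "m > 0" using m_ge_3 by simp

lemma v_mod: "v (i mod m) = v i"
proof -
  have "v (j + r * m) = v j" for r j
  proof (induction r)
    case (Suc r)
    then show ?case using periodic[of "j + r * m"] by (simp add: add_ac)
  qed simp
  from this[of "i mod m" "i div m"] show ?thesis by (simp add: mod_div_mult_eq)
qed

lemma v_cong: "i mod m = j mod m \<Longrightarrow> v i = v j"
  by (metis v_mod)

lemma v_Suc_mod: "v (Suc (i mod m)) = v (Suc i)"
  by (rule v_cong) (simp add: mod_Suc_eq)

lemma e_mod: "e (i mod m) z = e i z"
  by (simp add: e_def v_mod v_Suc_mod)

lemma e_m: "e m z = e 0 z"
  using e_mod[of m z] by simp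

lemma e_periodic: "e (i + m) z = e i z"
  using e_mod[of "i + m" z] e_mod[of i z] by simp

lemma a_periodic: "a (i + m) = a i"
  using periodic[of i] periodic[of "Suc i"] periodic[of "Suc (Suc i)"] by (simp add: a_def)

lemma e_alt: "e i z = cr (v i - z) (v (Suc i) - z)"
  by (simp add: e_def orient_def cr_def algebra_simps)

lemma e_eq_inner:
  "e i z = cr (v i) (v (Suc i)) + vector [v i $ 2 - v (Suc i) $ 2, v (Suc i) $ 1 - v i $ 1] \<bullet> z"
  unfolding e_def by (rule orient_eq_inner)

lemma near_imp_e_eq_0: "near l i \<Longrightarrow> e i (v l) = 0"
  using v_cong[of l i] v_cong[of l "Suc i"] by (auto simp: near_def e_def)

lemma e_vertex_pos:
  assumes "\<not> near l i"
  shows "e i (v l) > 0"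
proof -
  define i' l' where "i' = i mod m" and "l' = l mod m"
  have i': "i' < m" "l' < m" using m_pos by (auto simp: i'_def l'_def)
  have n: "l' \<noteq> i'" "l' \<noteq> Suc i' mod m" using assms by (auto simp: near_def i'_def l'_def mod_Suc_eq)
  have "orient (v i') (v (Suc i')) (v l') > 0"
  proof (cases "Suc i' = m")
    case True
    then have "v (Suc i') = v 0" using periodic[of 0] by simp
    moreover have "0 < l'" "l' < i'" using n i' True by auto
    ultimately show ?thesis using ccw[of 0 l' i'] i' orient_rotate by metis
  next
    case False
    then have "l' < i' \<or> Suc i' < l'" using n i' by auto
    then show ?thesis using ccw[of l' i' "Suc i'"] ccw[of i' "Suc i'" l'] i' False orient_rotate
      by (metis Suc_lessI lessI)
  qed
  then show ?thesis by (simp add: e_def i'_def l'_def v_mod v_Suc_mod)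
qed

lemma e_vertex_nonneg: "e i (v l) \<ge> 0"
  using near_imp_e_eq_0 e_vertex_pos by (cases "near l i") (auto simp: less_imp_le)

lemma e_vertex_eq_0_iff: "e i (v l) = 0 \<longleftrightarrow> near l i"
  using near_imp_e_eq_0 e_vertex_pos by force

text \<open>This and the next lemma supply \<open>uniq\<close> of \<open>fan_decomposition\<close>,
  for the polygon and for its polar. With two vertices both edges would have the same ends, hence
  the use of \<open>m_ge_3\<close>.\<close>

lemma near_unique_edge: "near l i \<Longrightarrow> near (Suc l) i \<Longrightarrow> l mod m = i mod m"
  using m_ge_3 by (auto simp: near_def mod_Suc split: if_splits)

lemma near_unique_vertex: "near (Suc l) i \<Longrightarrow> near (Suc l) (Suc i) \<Longrightarrow> l mod m = i mod m"
  using m_ge_3 by (auto simp: near_def mod_Suc split: if_splits)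

lemma not_near_Suc_Suc: "\<not> near (Suc (Suc i)) i"
  using m_ge_3 by (auto simp: near_def mod_Suc split: if_splits)

lemma a_pos: "a i > 0"
  using e_vertex_pos[OF not_near_Suc_Suc] by (simp add: a_def e_def)

lemma v_in_K: "v i \<in> K"
proof -
  have "v (i mod m) \<in> v ` {..<m}" using m_pos by auto
  then show ?thesis unfolding K_def v_mod by (rule hull_inc)
qed

lemma convex_K: "convex K" by (simp add: K_def)

lemma e_K_nonneg:
  assumes "x \<in> K"
  shows "e i x \<ge> 0"
proof -
  have "K \<subseteq> {x. e i x \<ge> 0}"
    unfolding K_def
  proof (rule hull_minimal)
    have "{x. e i x \<ge> 0} = {x. vector [v i $ 2 - v (Suc i) $ 2, v (Suc i) $ 1 - v i $ 1] \<bullet> x \<ge> - cr (v i) (v (Suc i))}"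
      by (auto simp: e_eq_inner)
    then show "convex {x. e i x \<ge> 0}" by (simp add: convex_halfspace_ge)
  qed (auto simp: e_vertex_nonneg)
  then show ?thesis using assms by auto
qed

lemma v_Suc_neq: "v (Suc i) \<noteq> v i"
  using a_pos[of i] by (auto simp: a_def)

lemma continuous_e: "continuous_on S (e i)"
  unfolding e_eq_inner[abs_def] by (intro continuous_intros)

text \<open>Moving \<open>z\<close> changes each triangle by a term that telescopes around the
  polygon; so D of the overview does not depend on \<open>z\<close>.\<close>

lemma sum_e: "(\<Sum>i<m. e i z) = (\<Sum>i<m. e i 0)"
proof -
  have "(\<Sum>i<m. e i 0) - (\<Sum>i<m. e i z) = (\<Sum>i<m. cr z (v (Suc i)) - cr z (v i))"
    unfolding sum_subtractf[symmetric]
    by (intro sum.cong refl) (simp add: e_alt cr_def algebra_simps)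
  also have "\<dots> = 0" using periodic[of 0] by (intro sum_lessThan_telescope_periodic) simp
  finally show ?thesis by simp
qed

text \<open>Twice the area of the triangle that edge \<^term>\<open>Suc i\<close> of the polar body, dual to the
  vertex \<^term>\<open>v (Suc i)\<close>, spans with the origin.\<close>
definition dl :: "real^2 \<Rightarrow> nat \<Rightarrow> real" where "dl z i = a i / (e i z * e (Suc i) z)"

lemma w_inner: "w z i \<bullet> (x - z) = (e i z - e i x) / e i z"
proof -
  have "vector [v (Suc i) $ 2 - v i $ 2, v i $ 1 - v (Suc i) $ 1] \<bullet> (x - z) = e i z - e i x"
    by (simp add: e_eq_inner inner_vec_def sum_2 algebra_simps)
  then show ?thesis by (simp add: w_def)
qed

lemma w_m: "w z m = w z 0"
  using e_m periodic[of 0] periodic[of 1] by (simp add: w_def)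

context
  fixes z
  assumes z: "z \<in> Z"
begin

lemma e_pos: "e i z > 0" using z by (simp add: Z_def)

lemma dl_pos: "dl z i > 0" using e_pos a_pos by (simp add: dl_def)

text \<open>Up to a quarter turn, the two terms on the left are the consecutive polar vertices
  \<open>w z i\<close> and \<open>w z (Suc i)\<close>. Their difference is the polar edge dual to
  \<open>v (Suc i)\<close>, which is orthogonal to \<open>v (Suc i) - z\<close>.\<close>

lemma recursion:
  "(1 / e i z) *\<^sub>R (v (Suc i) - v i) - (1 / e (Suc i) z) *\<^sub>R (v (Suc (Suc i)) - v (Suc i))
    = dl z i *\<^sub>R (v (Suc i) - z)"
proof -
  have *: "e (Suc i) z *\<^sub>R (v (Suc i) - v i) - e i z *\<^sub>R (v (Suc (Suc i)) - v (Suc i)) = a i *\<^sub>R (v (Suc i) - z)"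
    by (simp add: e_alt a_def orient_def vec_eq_iff forall_2 cr_def algebra_simps)
  have "dl z i *\<^sub>R (v (Suc i) - z) = (1 / (e i z * e (Suc i) z)) *\<^sub>R (a i *\<^sub>R (v (Suc i) - z))"
    by (simp add: dl_def)
  also have "\<dots> = (1 / e i z) *\<^sub>R (v (Suc i) - v i) - (1 / e (Suc i) z) *\<^sub>R (v (Suc (Suc i)) - v (Suc i))"
    unfolding *[symmetric] using e_pos[of i] e_pos[of "Suc i"] by (simp add: scaleR_diff_right)
  finally show ?thesis by simp
qed

text \<open>The edges of the polar polygon close up. This also exhibits \<open>z\<close> as a convex
  combination of the vertices.\<close>

lemma sum_dl: "(\<Sum>i<m. dl z i *\<^sub>R (v (Suc i) - z)) = 0"
proof -
  define f where "f i = - (1 / e i z) *\<^sub>R (v (Suc i) - v i)" for i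
  have "(\<Sum>i<m. dl z i *\<^sub>R (v (Suc i) - z)) = (\<Sum>i<m. f (Suc i) - f i)"
    unfolding recursion[symmetric] by (simp add: f_def)
  also have "\<dots> = 0" using periodic[of 0] periodic[of 1] e_m
    by (intro sum_lessThan_telescope_periodic) (simp add: f_def)
  finally show ?thesis .
qed

lemma z_in_K: "z \<in> K"
proof -
  define s where "s = (\<Sum>i<m. dl z i)"
  have s: "s > 0" unfolding s_def using m_pos dl_pos by (intro sum_pos) auto
  have "(\<Sum>i<m. dl z i *\<^sub>R v (Suc i)) = s *\<^sub>R z"
    using sum_dl by (simp add: scaleR_diff_right sum_subtractf s_def scaleR_left.sum)
  then have "z = (1 / s) *\<^sub>R (\<Sum>i<m. dl z i *\<^sub>R v (Suc i))" using s by simp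
  also have "\<dots> = (\<Sum>i<m. (dl z i / s) *\<^sub>R v (Suc i))" by (simp add: scaleR_sum_right)
  also have "\<dots> \<in> K"
    using s dl_pos v_in_K by (intro convex_sum convex_K) (auto simp: sum_divide_distrib[symmetric] s_def less_imp_le)
  finally show ?thesis .
qed

lemma K_fan:
  "(\<lambda>x. x - z) ` K = {x. \<forall>i<m. w z i \<bullet> x \<le> 1}"
  "area {x. \<forall>i<m. w z i \<bullet> x \<le> 1} = (\<Sum>i<m. e i z) / 2"
proof -
  \<comment> \<open>\<open>dl z i\<close> is attached to \<open>v (Suc i)\<close>, whereas the fan
    needs a weight for \<open>v i\<close>; \<open>i + m - 1\<close> steps back cyclically.\<close>
  define c where "c i = dl z (i + m - 1)" for i
  have "(\<Sum>i<m. c (Suc i) *\<^sub>R (v (Suc i) - z)) = (\<Sum>i<m. dl z i *\<^sub>R (v (Suc i) - z))"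
    by (intro sum.cong refl) (simp add: c_def dl_def a_periodic e_periodic e_periodic[of "Suc _", simplified])
  moreover have "c m = c 0" 
    using a_periodic[of "m - 1"] e_periodic[of "m - 1"] e_periodic[of m] e_m m_pos by (simp add: c_def dl_def)
  ultimately have bal: "(\<Sum>i<m. c i *\<^sub>R (v i - z)) = 0"
    using sum_lessThan_shift_periodic[of "\<lambda>i. c i *\<^sub>R (v i - z)" m] sum_dl periodic[of 0] by simp
  have w: "w z i \<bullet> (v j - z) = 1 - e i (v j) / e i z" for i j
    using e_pos[of i] by (simp add: w_inner diff_divide_distrib)
  have closed: "v m - z = v 0 - z" using periodic[of 0] by simp
  have d: "cr (v i - z) (v (Suc i) - z) > 0" for i using e_pos[of i] by (simp add: e_alt)
  have w1: "w z i \<bullet> (v i - z) = 1" and w2: "w z i \<bullet> (v (Suc i) - z) = 1" for i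
    by (simp_all add: w near_imp_e_eq_0 near_def)
  have le: "w z i \<bullet> (v j - z) \<le> 1" for i j
    using e_vertex_nonneg[of i j] e_pos[of i] by (simp add: w)
  have uniq: "i = j" if "i < m" "j < m" "w z i \<bullet> (v j - z) = 1" "w z i \<bullet> (v (Suc j) - z) = 1" for i j
    using that near_unique_edge[of j i] e_pos[THEN less_imp_neq, THEN not_sym] by (simp add: w e_vertex_eq_0_iff)
  have c: "c i > 0" for i using dl_pos by (simp add: c_def)
  note fan = fan_decomposition[of m "\<lambda>i. v i - z" "w z" c, OF m_pos closed d w1 w2 le uniq c bal]
  have fan1: "{x. \<forall>i<m. w z i \<bullet> x \<le> 1} = (\<Union>i<m. convex hull {0, v i - z, v (Suc i) - z})"
    by (rule fan(1))
  have fan2: "area {x. \<forall>i<m. w z i \<bullet> x \<le> 1} = (\<Sum>i<m. cr (v i - z) (v (Suc i) - z)) / 2"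
    by (rule fan(2))
  show "area {x. \<forall>i<m. w z i \<bullet> x \<le> 1} = (\<Sum>i<m. e i z) / 2"
    using fan2 by (simp add: e_alt)
  show "(\<lambda>x. x - z) ` K = {x. \<forall>i<m. w z i \<bullet> x \<le> 1}"
  proof
    show "(\<lambda>x. x - z) ` K \<subseteq> {x. \<forall>i<m. w z i \<bullet> x \<le> 1}"
      using e_pos e_K_nonneg by (auto simp: w_inner)
    have "convex ((\<lambda>x. x - z) ` K)" using convex_translation[OF convex_K, of "- z"] by simp
    then show "{x. \<forall>i<m. w z i \<bullet> x \<le> 1} \<subseteq> (\<lambda>x. x - z) ` K"
      unfolding fan1 using z_in_K v_in_K by (intro UN_least hull_minimal) auto
  qed
qed

lemma area_K: "area K = (\<Sum>i<m. e i 0) / 2"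
proof -
  have "area ((\<lambda>x. x - z) ` K) = area K"
    using measure_translation[of "- z" K] by simp
  then show ?thesis using K_fan sum_e[of z] by simp
qed

text \<open>The fan with exchanged roles: the \<open>w z i\<close> are the vertices and the
  \<open>v (Suc i) - z\<close> the normals. The weights \<open>e i z\<close> turn the
  \<open>w z i\<close> into rotated edges of the polygon, whose sum is zero.\<close>

lemma polar_area: "polar_area_at K z = (\<Sum>i<m. dl z i) / 2"
proof -
  have cr_w: "cr (w z i) (w z (Suc i)) = dl z i" for i
  proof -
    have "cr (vector [v (Suc i) $ 2 - v i $ 2, v i $ 1 - v (Suc i) $ 1])
      (vector [v (Suc (Suc i)) $ 2 - v (Suc i) $ 2, v (Suc i) $ 1 - v (Suc (Suc i)) $ 1]) = a i"
      by (simp add: cr_def a_def orient_def algebra_simps)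
    then show ?thesis unfolding w_def dl_def cr_algebra by simp
  qed
  have "polar_body ((\<lambda>x. x - z) ` K) = {x. \<forall>i<m. (v (Suc i) - z) \<bullet> x \<le> 1}"
  proof (intro equalityI subsetI)
    fix x assume "x \<in> polar_body ((\<lambda>x. x - z) ` K)"
    then show "x \<in> {x. \<forall>i<m. (v (Suc i) - z) \<bullet> x \<le> 1}"
      using v_in_K by (auto simp: polar_body_def inner_commute)
  next
    fix x assume "x \<in> {x. \<forall>i<m. (v (Suc i) - z) \<bullet> x \<le> 1}"
    then have *: "x \<bullet> v (Suc i) \<le> 1 + x \<bullet> z" if "i < m" for i
      using that by (force simp: inner_diff_right inner_commute[of _ x])
    have "x \<bullet> v i \<le> 1 + x \<bullet> z" if "i < m" for i
      using *[of "i - 1"] *[of "m - 1"] periodic[of 0] m_pos that by (cases i) auto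
    then have "K \<subseteq> {y. x \<bullet> y \<le> 1 + x \<bullet> z}"
      unfolding K_def by (intro hull_minimal convex_halfspace_le) auto
    then show "x \<in> polar_body ((\<lambda>x. x - z) ` K)"
      by (auto simp: polar_body_def inner_diff_right)
  qed
  moreover have "area {x. \<forall>i<m. (v (Suc i) - z) \<bullet> x \<le> 1} = (\<Sum>i<m. cr (w z i) (w z (Suc i))) / 2"
  proof (rule fan_decomposition(2)[where c = "\<lambda>i. e i z"])
    show "w z m = w z 0" by (rule w_m)
    have w: "(v j - z) \<bullet> w z i = 1 - e i (v j) / e i z" for i j
      using e_pos[of i] by (simp add: inner_commute[of _ "w z i"] w_inner diff_divide_distrib)
    have "(\<Sum>i<m. e i z *\<^sub>R w z i) = (\<Sum>i<m. vector [v (Suc i) $ 2, - (v (Suc i) $ 1)] - vector [v i $ 2, - (v i $ 1)])"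
      using e_pos[THEN less_imp_neq] by (intro sum.cong refl) (auto simp: w_def vec_eq_iff forall_2)
    also have "\<dots> = 0" using periodic[of 0] by (intro sum_lessThan_telescope_periodic) simp
    finally show "(\<Sum>i<m. e i z *\<^sub>R w z i) = 0" .
    show "cr (w z i) (w z (Suc i)) > 0" for i using dl_pos[of i] by (simp add: cr_w)
    show "(v (Suc i) - z) \<bullet> w z i = 1" for i by (simp add: w near_imp_e_eq_0 near_def)
    show "(v (Suc i) - z) \<bullet> w z (Suc i) = 1" for i by (simp add: w near_imp_e_eq_0 near_def)
    show "(v (Suc i) - z) \<bullet> w z j \<le> 1" for i j
      using e_vertex_nonneg[of j "Suc i"] e_pos[of j] by (simp add: w)
    show "i = j" if "i < m" "j < m" "(v (Suc i) - z) \<bullet> w z j = 1" "(v (Suc i) - z) \<bullet> w z (Suc j) = 1" for i j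
      using that near_unique_vertex[of i j] e_pos[THEN less_imp_neq, THEN not_sym] by (simp add: w e_vertex_eq_0_iff)
  qed (use m_pos e_pos in auto)
  ultimately show ?thesis by (simp add: polar_area_at_def cr_w)
qed

end

lemma interior_K: "interior K = Z"
proof
  show "interior K \<subseteq> Z"
  proof
    fix x assume x: "x \<in> interior K"
    have "e i x > 0" for i
    proof -
      let ?b = "vector [v i $ 2 - v (Suc i) $ 2, v (Suc i) $ 1 - v i $ 1] :: real^2"
      have "?b \<noteq> 0" using v_Suc_neq[of i] by (auto simp: vec_eq_iff forall_2)
      then have "interior {x. ?b \<bullet> x \<ge> - cr (v i) (v (Suc i))} = {x. ?b \<bullet> x > - cr (v i) (v (Suc i))}"
        by (rule interior_halfspace_ge)
      moreover have "K \<subseteq> {x. ?b \<bullet> x \<ge> - cr (v i) (v (Suc i))}" 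
        using e_K_nonneg[of _ i] by (force simp: e_eq_inner)
      ultimately have "?b \<bullet> x > - cr (v i) (v (Suc i))" using x interior_mono by blast
      then show ?thesis by (simp add: e_eq_inner)
    qed
    then show "x \<in> Z" by (simp add: Z_def)
  qed
  have "Z = (\<Inter>i<m. {z. 0 < e i z})"
  proof (intro equalityI subsetI)
    fix x assume x: "x \<in> (\<Inter>i<m. {z. 0 < e i z})"
    have "0 < e i x" for i
    proof -
      have "i mod m < m" using m_pos by simp
      then have "0 < e (i mod m) x" using x by blast
      then show ?thesis by (simp add: e_mod)
    qed
    then show "x \<in> Z" by (simp add: Z_def)
  qed (auto simp: Z_def)
  then have "open Z" by (simp add: open_INT open_Collect_less continuous_e)
  then show "Z \<subseteq> interior K" using z_in_K by (intro interior_maximal) auto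
qed

end

section \<open>Balanced points\<close>

context ccw_polygon
begin

text \<open>From the three-term determinant identity for the vectors that lead from
  \<open>v 0\<close> to \<open>v 1\<close>, \<open>v i\<close>, \<open>v j\<close> and
  \<open>z\<close>. It yields the single sign change that \<open>mixed_area_form\<close>
  demands.\<close>

lemma u_decreasing:
  assumes z: "z \<in> Z" and ij: "0 < i" "i < j" "j < m" and le: "orient (v 0) (v i) z \<le> 0"
  shows "orient (v 0) (v j) z < 0"
proof -
  define p b c f where "p = z - v 0" and "b = v i - v 0" and "c = v j - v 0" and "f = v 1 - v 0"
  have pos: "cr f p > 0" using e_pos[OF z, of 0] by (simp add: e_def orient_def f_def p_def)
  have bc: "cr b c > 0" using ccw[of 0 i j] ij by (simp add: orient_def b_def c_def)
  have fb: "cr f b \<ge> 0" using e_vertex_nonneg[of 0 i] by (simp add: e_def orient_def f_def b_def)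
  have fc: "cr f c > 0" using ccw[of 0 1 j] ij by (simp add: orient_def f_def c_def)
  have bp: "cr b p \<le> 0" using le by (simp add: orient_def b_def p_def)
  have "cr f p * cr b c + cr f b * cr c p = cr f c * cr b p"
    by (simp add: cr_def algebra_simps)
  moreover have "cr f p * cr b c > 0" "cr f c * cr b p \<le> 0"
    using pos bc fc bp by (auto simp: mult_nonneg_nonpos)
  ultimately have "cr f b * cr c p < 0" by linarith
  then have "cr c p < 0" using fb by (auto simp: mult_less_0_iff)
  then show ?thesis by (simp add: orient_def c_def p_def)
qed

lemma mixed_area_form_at:
  assumes z: "z \<in> Z"
  shows "\<exists>k. mixed_area_form m (\<lambda>i. v i - z) (dl z) k"
proof -
  define u where "u i = orient (v 0) (v i) z" for i
  have u: "cr (v 0 - z) (v i - z) = u i" for i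
    by (simp add: u_def orient_def cr_def algebra_simps)
  have last: "u (m - 1) < 0"
  proof -
    have "u (m - 1) = - e (m - 1) z"
      using periodic[of 0] m_pos by (simp add: u_def e_def orient_def cr_def algebra_simps)
    then show ?thesis using e_pos[OF z] by simp
  qed
  have ex: "u (Suc (m - 2)) \<le> 0" using last m_ge_3 by (simp add: Suc_diff_le numeral_2_eq_2 Suc_diff_Suc)
  \<comment> \<open>Index of the last vertex before the sign change. The search ends by
    \<open>m - 2\<close>, because \<open>u (m - 1) = - e (m - 1) z\<close>.\<close>
  define k where "k = (LEAST k. u (Suc k) \<le> 0)"
  have k1: "u (Suc k) \<le> 0" unfolding k_def using ex by (rule LeastI)
  have k2: "k \<le> m - 2" unfolding k_def using ex by (rule Least_le)
  have k3: "u (Suc i) > 0" if "i < k" for i using not_less_Least[of i "\<lambda>k. u (Suc k) \<le> 0"] that by (simp add: k_def)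
  have k0: "0 < k"
  proof (rule ccontr)
    assume "\<not> 0 < k"
    then show False using k1 e_pos[OF z, of 0] by (simp add: u_def e_def)
  qed
  have km: "Suc k < m" using k2 m_ge_3 by simp
  have "mixed_area_form m (\<lambda>i. v i - z) (dl z) k"
  proof
    show "0 < cr (v i - z) (v (Suc i) - z)" for i using e_pos[OF z, of i] by (simp add: e_alt)
    show "(1 / cr (v i - z) (v (Suc i) - z)) *\<^sub>R (v (Suc i) - z - (v i - z)) -
         (1 / cr (v (Suc i) - z) (v (Suc (Suc i)) - z)) *\<^sub>R (v (Suc (Suc i)) - z - (v (Suc i) - z)) =
         dl z i *\<^sub>R (v (Suc i) - z)" for i
      using recursion[OF z, of i] by (simp add: e_alt)
    show "0 < cr (v 0 - z) (v i - z)" if "0 < i" "i \<le> k" for i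
      using k3[of "i - 1"] that unfolding u by simp
    show "cr (v 0 - z) (v i - z) < 0" if "Suc k < i" "i < m" for i
      using u_decreasing[OF z _ that] k1 unfolding u u_def by simp
    show "cr (v 0 - z) (v (Suc k) - z) \<le> 0" using k1 unfolding u .
    show "dl z (i + m) = dl z i" for i
      using e_periodic[of i] e_periodic[of "Suc i"] a_periodic[of i] by (simp add: dl_def)
  qed (use m_pos periodic k0 km dl_pos[OF z] in auto)
  then show ?thesis ..
qed

section \<open>The moment map and its winding along the boundary\<close>

definition total :: real where "total = (\<Sum>i<m. e i 0)"

definition arg :: "nat \<Rightarrow> real^2 \<Rightarrow> real" where "arg k z = 2 * pi * (\<Sum>j<k. e j z) / total"

definition weight :: "nat \<Rightarrow> real^2 \<Rightarrow> real" where
  "weight i z = a i * (\<Prod>j\<in>{..<m} - {i, Suc i mod m}. e j z)"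

text \<open>The moment of the masses \<^term>\<open>dl z i\<close> placed on the unit circle, multiplied by
  \<^term>\<open>\<Prod>i<m. e i z\<close> in order to extend continuously to the boundary of \<^term>\<open>K\<close>.\<close>
definition moment :: "real^2 \<Rightarrow> complex" where
  "moment z = (\<Sum>i<m. complex_of_real (weight i z) * cis (arg (Suc i) z))"

lemma Suc_mod_neq: "i < m \<Longrightarrow> i \<noteq> Suc i mod m"
  using m_ge_3 by (auto simp: mod_Suc split: if_splits)

lemma total_pos: "z \<in> Z \<Longrightarrow> total > 0"
  unfolding total_def using m_pos e_pos by (subst sum_e[of z, symmetric]) (auto intro!: sum_pos)

lemma arg_Suc: "arg (Suc k) z = arg k z + 2 * pi * e k z / total"
  by (simp add: arg_def algebra_simps add_divide_distrib)

lemma arg_m: "total > 0 \<Longrightarrow> arg m z = 2 * pi"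
  by (simp add: arg_def sum_e[of z] flip: total_def)

lemma arg_periodic: "total > 0 \<Longrightarrow> cis (arg (i + m) z) = cis (arg i z)"
proof -
  assume t: "total > 0"
  have "arg (i + m) z = arg i z + 2 * pi"
    by (induction i) (use t in \<open>auto simp: arg_m arg_Suc e_periodic arg_def[of 0]\<close>)
  then show ?thesis by (simp add: cis_mult[symmetric])
qed

text \<open>Only the weights that omit the factor \<open>e k\<close>, those of \<open>k\<close> and
  its predecessor, survive on edge \<open>k\<close>. Their angles \<open>arg (Suc k)\<close> and
  \<open>arg k\<close> agree there, up to full turns, because the step between them is proportional
  to \<open>e k x = 0\<close>.\<close>

lemma moment_on_edge:
  assumes tot: "total > 0" and x: "x \<in> K" and k: "k < m" and ek: "e k x = 0"
  obtains c where "c > 0" "moment x = complex_of_real c * cis (arg k x)"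
proof
  have y: "complex_of_real (weight i x) * cis (arg (Suc i) x) = complex_of_real (weight i x) * cis (arg k x)" if i: "i < m" for i
  proof -
    consider "i = k" | "k = Suc i mod m" | "k \<noteq> i" "k \<noteq> Suc i mod m" by blast
    then show ?thesis
    proof cases
      case 1 then show ?thesis using ek by (simp add: arg_Suc)
    next
      case 2 
      then show ?thesis using arg_periodic[OF tot, of 0 x] i by (cases "Suc i = m") auto
    next
      case 3
      have "weight i x = 0" unfolding weight_def using k ek 3 by (auto intro!: bexI[of _ k])
      then show ?thesis by simp
    qed
  qed
  show "moment x = complex_of_real (\<Sum>i<m. weight i x) * cis (arg k x)"
    unfolding moment_def of_real_sum sum_distrib_right by (intro sum.cong refl y) simp
  have nonneg: "weight i x \<ge> 0" for i
    unfolding weight_def using a_pos[of i] e_K_nonneg[OF x] by (intro mult_nonneg_nonneg prod_nonneg) auto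
  obtain \<tau> where "x - v k = \<tau> *\<^sub>R (v (Suc k) - v k)"
  proof -
    have nz: "v (Suc k) - v k \<noteq> 0" using v_Suc_neq by simp
    define D where "D = v (Suc k) - v k"
    have "cr D (x - v k) = 0" using ek by (simp add: e_def orient_def D_def)
    then have "(D \<bullet> D) *\<^sub>R (x - v k) = (D \<bullet> (x - v k)) *\<^sub>R D"
      by (simp add: cr_def vec_eq_iff forall_2 inner_vec_def sum_2) algebra
    then have "(1 / (D \<bullet> D)) *\<^sub>R ((D \<bullet> D) *\<^sub>R (x - v k)) = (1 / (D \<bullet> D)) *\<^sub>R ((D \<bullet> (x - v k)) *\<^sub>R D)" by simp
    then show thesis using nz that unfolding D_def by simp
  qed
  then have xt: "x = v k + \<tau> *\<^sub>R (v (Suc k) - v k)" by (simp add: algebra_simps)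
  have ex: "e j x = (1 - \<tau>) * e j (v k) + \<tau> * e j (v (Suc k))" for j
    unfolding xt by (simp add: e_def orient_def cr_def algebra_simps)
  define k' where "k' = (if k = 0 then m - 1 else k - 1)"
  have k': "k' < m" "Suc k' mod m = k" using k m_pos by (auto simp: k'_def)
  have "\<tau> \<ge> 0"
  proof -
    have "near k k'" "\<not> near (Suc k) k'"
      using k k' m_ge_3 by (auto simp: near_def mod_Suc split: if_splits)
    then show ?thesis using ex[of k'] e_K_nonneg[OF x, of k'] e_vertex_pos[of "Suc k" k'] near_imp_e_eq_0[of k k']
      by (simp add: zero_le_mult_iff)
  qed
  have "\<tau> \<le> 1"
  proof -
    have "near (Suc k) (Suc k)" "\<not> near k (Suc k)"
      using k m_ge_3 by (auto simp: near_def mod_Suc split: if_splits)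
    then show ?thesis using ex[of "Suc k"] e_K_nonneg[OF x, of "Suc k"] e_vertex_pos[of k "Suc k"] near_imp_e_eq_0[of "Suc k" "Suc k"]
      by (simp add: zero_le_mult_iff)
  qed
  \<comment> \<open>At the vertex \<open>v k\<close> the weight of the preceding index
    \<open>k'\<close> is positive; elsewhere on the edge, including \<open>v (Suc k)\<close>, that
    of \<open>k\<close> is.\<close>
  have "\<exists>i<m. weight i x > 0"
  proof (cases "\<tau> = 0")
    case True
    have "e j x > 0" if "j \<in> {..<m} - {k', Suc k' mod m}" for j
    proof -
      have "\<not> near k j"
        using that k k' m_ge_3 by (auto simp: near_def mod_Suc split: if_splits)
      then show ?thesis using ex[of j] True e_vertex_pos[of k j] by simp
    qed
    then show ?thesis using k' a_pos[of k'] unfolding weight_def by (auto intro!: exI[of _ k'] mult_pos_pos prod_pos)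
  next
    case False
    have "e j x > 0" if "j \<in> {..<m} - {k, Suc k mod m}" for j
    proof -
      have "\<not> near (Suc k) j"
        using that k m_ge_3 by (auto simp: near_def mod_Suc split: if_splits)
      then show ?thesis using ex[of j] False \<open>\<tau> \<ge> 0\<close> \<open>\<tau> \<le> 1\<close> e_vertex_pos[of "Suc k" j] e_vertex_nonneg[of j k]
        by (simp add: add_nonneg_pos)
    qed
    then show ?thesis using k a_pos[of k] unfolding weight_def by (auto intro!: exI[of _ k] mult_pos_pos prod_pos)
  qed
  then show "(\<Sum>i<m. weight i x) > 0" using nonneg by (auto intro: sum_pos2)
qed

lemma continuous_arg: "continuous_on S (arg k)"
proof -
  have "arg k = (\<lambda>z. (2 * pi / total) * (\<Sum>j<k. e j z))" by (simp add: arg_def[abs_def])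
  then show ?thesis by (simp only:) (intro continuous_intros continuous_e)
qed

lemma continuous_moment: "continuous_on S moment"
  unfolding moment_def[abs_def] weight_def[abs_def] cis_conv_exp
  by (intro continuous_intros continuous_e continuous_arg)

text \<open>On edge \<^term>\<open>k\<close> the moment has argument \<^term>\<open>arg k\<close>, which increases by \<^term>\<open>2 * pi\<close> once
  around the boundary. So the moment has winding number 1 there and a zero inside.\<close>
theorem ex_balanced_point:
  assumes tot: "total > 0"
  shows "\<exists>z\<in>Z. (\<Sum>i<m. complex_of_real (dl z i) * cis (arg (Suc i) z)) = 0"
proof -
  have "\<exists>z\<in>K. moment z = 0"
  proof (rule ccontr)
    assume "\<not> ?thesis"
    then have nz: "\<And>z. z \<in> K \<Longrightarrow> moment z \<noteq> 0" by blast
    obtain h where h: "continuous_on K h" "\<And>x. x \<in> K \<Longrightarrow> moment x = exp (h x)"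
      using continuous_logarithm_on_contractible[OF continuous_moment convex_imp_contractible[OF convex_K] nz] by blast
    \<comment> \<open>Counts full turns between the continuous argument from \<open>h\<close> and
      \<open>arg k\<close>. It is an integer, hence constant, on edge \<open>k\<close>, and
      unchanged in passing to \<open>Suc k\<close> at the common vertex, where \<open>e k\<close>
      vanishes; yet \<open>arg\<close> gains \<open>2 * pi\<close> in one round.\<close>
    define N where "N k x = (Im (h x) - arg k x) / (2 * pi)" for k x
    have step: "N (Suc k) (v (Suc k)) = N k (v k)" if k: "k < m" for k
    proof -
      let ?S = "closed_segment (v k) (v (Suc k))"
      have SK: "?S \<subseteq> K" using v_in_K convex_K by (simp add: closed_segment_subset)
      have int: "N k x \<in> \<int>" if x: "x \<in> ?S" for x
      proof -
        obtain t where xt: "x = (1 - t) *\<^sub>R v k + t *\<^sub>R v (Suc k)" using x by (auto simp: closed_segment_def)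
        have "e k x = 0" unfolding xt by (simp add: e_def orient_def cr_def algebra_simps)
        then obtain c where c: "c > 0" "moment x = complex_of_real c * cis (arg k x)"
          using moment_on_edge[OF tot _ k, of x] x SK by blast
        have "exp (h x) = complex_of_real c * cis (arg k x)" using h(2)[of x] c x SK by auto
        then have eq: "complex_of_real (exp (Re (h x))) * cis (Im (h x)) = complex_of_real c * cis (arg k x)"
          by (simp add: exp_eq_polar)
        have "exp (Re (h x)) = cmod (complex_of_real (exp (Re (h x))) * cis (Im (h x)))"
          unfolding norm_mult norm_cis norm_of_real by simp
        also have "\<dots> = c" unfolding eq norm_mult norm_cis norm_of_real using c(1) by simp
        finally have "exp (Re (h x)) = c" .
        then have "cis (Im (h x)) = cis (arg k x)" using eq c by simp
        then have "cis (Im (h x) - arg k x) = 1" by (simp add: cis_divide[symmetric])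
        then have "cos (Im (h x) - arg k x) = 1" by (simp add: complex_eq_iff)
        then obtain n :: int where "Im (h x) - arg k x = of_int n * (2 * pi)"
          by (auto simp: cos_one_2pi_int)
        then show ?thesis by (simp add: N_def)
      qed
      have "N k constant_on ?S"
      proof (rule continuous_discrete_range_constant)
        show "continuous_on ?S (N k)"
          unfolding N_def[abs_def] using h(1) SK
          by (intro continuous_intros continuous_arg) (auto intro: continuous_on_subset)
        show "\<exists>e>0. \<forall>y. y \<in> ?S \<and> N k y \<noteq> N k x \<longrightarrow> e \<le> norm (N k y - N k x)" if "x \<in> ?S" for x
        proof (intro exI[of _ 1] conjI allI impI)
          fix y assume "y \<in> ?S \<and> N k y \<noteq> N k x"
          then have "N k y - N k x \<in> \<int>" "N k y - N k x \<noteq> 0" using int that by auto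
          then show "1 \<le> norm (N k y - N k x)" using Ints_nonzero_abs_ge1[of "N k y - N k x"] by auto
        qed simp
      qed simp
      then have "N k (v (Suc k)) = N k (v k)" 
        unfolding constant_on_def using ends_in_segment by metis
      moreover have "N (Suc k) (v (Suc k)) = N k (v (Suc k))"
        by (simp add: N_def arg_Suc near_imp_e_eq_0 near_def)
      ultimately show ?thesis by simp
    qed
    have "N k (v k) = N 0 (v 0)" if "k \<le> m" for k
      using that by (induction k) (auto simp: step)
    from this[of m] have "N m (v 0) = N 0 (v 0)" using periodic[of 0] by simp
    then show False using arg_m[OF tot] by (simp add: N_def arg_def[of 0])
  qed
  then obtain z where z: "z \<in> K" "moment z = 0" by blast
  have pos: "e i z > 0" if "i < m" for i
  proof (rule ccontr)
    assume "\<not> ?thesis"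
    then have "e i z = 0" using e_K_nonneg[OF z(1), of i] by simp
    then show False using moment_on_edge[OF tot z(1) that] z(2) by auto
  qed
  have zZ: "z \<in> Z" unfolding Z_def
  proof safe
    fix i
    show "e i z > 0" using pos[of "i mod m"] m_pos by (simp add: e_mod)
  qed
  define P where "P = (\<Prod>j<m. e j z)"
  have P: "P > 0" unfolding P_def using pos by (intro prod_pos) auto
  have "dl z i = weight i z / P" if i: "i < m" for i
  proof -
    define R where "R = (\<Prod>j\<in>{..<m} - {i, Suc i mod m}. e j z)"
    have "R > 0" unfolding R_def using pos by (intro prod_pos) auto
    have "{..<m} - {i} - {Suc i mod m} = {..<m} - {i, Suc i mod m}" by auto
    then have "P = e i z * (e (Suc i mod m) z * R)"
      using prod.remove[of "{..<m}" i "\<lambda>j. e j z"] prod.remove[of "{..<m} - {i}" "Suc i mod m" "\<lambda>j. e j z"]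
        i Suc_mod_neq[OF i] m_pos by (simp add: P_def R_def)
    moreover have "weight i z = a i * R" by (simp add: weight_def R_def)
    ultimately show ?thesis using \<open>R > 0\<close> by (simp add: dl_def e_mod[of "Suc i"])
  qed
  then have "(\<Sum>i<m. complex_of_real (dl z i) * cis (arg (Suc i) z)) = moment z / P"
    unfolding moment_def sum_divide_distrib by (intro sum.cong refl) simp
  then show ?thesis using zZ z(2) by (intro bexI[of _ z]) auto
qed

end

section \<open>The bound and its equality case\<close>

definition unit_vec :: "real \<Rightarrow> real^2" where "unit_vec t = vector [cos t, sin t]"

lemma regular_polygon_eq:
  "regular_polygon n r \<theta> = convex hull ((\<lambda>k. r *\<^sub>R unit_vec (\<theta> + 2 * pi * real k / real n)) ` {..<n})"
proof -
  have "vector [r * cos t, r * sin t] = r *\<^sub>R unit_vec t" for t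
    by (simp add: unit_vec_def vec_eq_iff forall_2)
  then show ?thesis by (simp add: regular_polygon_def)
qed

lemma unit_vec_recursion: "unit_vec (t + 2 * s) = (2 * cos s) *\<^sub>R unit_vec (t + s) - unit_vec t"
proof -
  have "unit_vec (t + s + s) + unit_vec (t + s - s) = (2 * cos s) *\<^sub>R unit_vec (t + s)"
    by (simp only: unit_vec_def vec_eq_iff forall_2 cos_add sin_add cos_diff sin_diff) (simp add: algebra_simps)
  then show ?thesis by (simp add: algebra_simps)
qed

lemma cr_unit_vec: "cr (unit_vec s) (unit_vec t) = sin (t - s)"
  by (simp add: cr_def unit_vec_def sin_diff algebra_simps)

text \<open>A second order recursion is fixed by its first two terms: \<open>f\<close> sends the
  basis vectors to \<open>p 0\<close> and to \<open>b\<close>, the solution of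
  \<open>p 1 = cos \<alpha> *\<^sub>R p 0 + sin \<alpha> *\<^sub>R b\<close>. Independence of
  \<open>p 0\<close> and \<open>p 1\<close> makes it bijective.\<close>

lemma linear_image_if_same_recursion:
  fixes p :: "nat \<Rightarrow> real^2"
  assumes rec: "\<And>i. p (Suc (Suc i)) = (2 * cos \<alpha>) *\<^sub>R p (Suc i) - p i"
    and \<alpha>: "sin \<alpha> \<noteq> 0" and nz: "cr (p 0) (p 1) \<noteq> 0"
  obtains f :: "real^2 \<Rightarrow> real^2" where "linear f" "bij f" "\<And>i. p i = f (unit_vec (real i * \<alpha>))"
proof -
  define b where "b = (1 / sin \<alpha>) *\<^sub>R (p 1 - cos \<alpha> *\<^sub>R p 0)"
  define f where "f x = (x $ 1) *\<^sub>R p 0 + (x $ 2) *\<^sub>R b" for x :: "real^2"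
  have lin: "linear f" by (intro linearI) (auto simp: f_def algebra_simps)
  have b: "cr (p 0) b = cr (p 0) (p 1) / sin \<alpha>" by (simp add: b_def cr_algebra)
  have "inj f"
  proof (subst linear_injective_0[OF lin], safe)
    fix x assume x: "f x = 0"
    have "cr (p 0) (f x) = 0" "cr (f x) b = 0" using x by (auto simp: cr_algebra)
    then show "x = 0" using b nz \<alpha> by (auto simp: f_def cr_algebra vec_eq_iff forall_2)
  qed
  then have "bij f" using linear_injective_imp_surjective[OF lin] by (auto simp: bij_def)
  moreover have "p i = f (unit_vec (real i * \<alpha>)) \<and> p (Suc i) = f (unit_vec (real (Suc i) * \<alpha>))" for i
  proof (induction i)
    case 0
    show ?case using \<alpha> by (simp add: f_def unit_vec_def b_def)
  next
    case (Suc i)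
    have "f (unit_vec (real (Suc (Suc i)) * \<alpha>)) = f (unit_vec (real i * \<alpha> + 2 * \<alpha>))" by (simp add: algebra_simps)
    also have "\<dots> = (2 * cos \<alpha>) *\<^sub>R f (unit_vec (real i * \<alpha> + \<alpha>)) - f (unit_vec (real i * \<alpha>))"
      by (simp only: unit_vec_recursion linear_diff[OF lin] linear_scale[OF lin])
    also have "real i * \<alpha> + \<alpha> = real (Suc i) * \<alpha>" by (simp add: algebra_simps)
    also have "(2 * cos \<alpha>) *\<^sub>R f (unit_vec (real (Suc i) * \<alpha>)) - f (unit_vec (real i * \<alpha>)) = p (Suc (Suc i))"
      using Suc rec[of i] by simp
    finally show ?case using Suc by simp
  qed
  ultimately show thesis using that lin by blast
qed

lemma norm_cis_diff_sq:
  fixes s t :: real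
  shows "(cos s - cos t)\<^sup>2 + (sin s - sin t)\<^sup>2 = 4 * (sin ((s - t) / 2))\<^sup>2"
proof -
  have "(cos s - cos t)\<^sup>2 + (sin s - sin t)\<^sup>2 = ((cos s)\<^sup>2 + (sin s)\<^sup>2) + ((cos t)\<^sup>2 + (sin t)\<^sup>2) - 2 * cos (s - t)"
    by (simp only: cos_diff) (simp add: power2_eq_square algebra_simps)
  also have "\<dots> = 2 - 2 * cos (2 * ((s - t) / 2))"
  proof -
    have "2 * ((s - t) / 2) = s - t" by simp
    then show ?thesis by (simp only: sin_cos_squared_add2)
  qed
  also have "\<dots> = 4 * (sin ((s - t) / 2))\<^sup>2" by (simp only: cos_double_sin) simp
  finally show ?thesis .
qed

context ccw_polygon
begin

text \<open>The trial functions \<^term>\<open>\<lambda>i. cos (arg i z)\<close> and \<^term>\<open>\<lambda>i. sin (arg i z)\<close> are orthogonal to the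
  constants at a balanced point, where the mixed area form is thus nonnegative on them.\<close>
theorem area_product_bound:
  assumes "Z \<noteq> {}"
  obtains z where "z \<in> Z"
    "\<And>n. m \<le> n \<Longrightarrow> area K * polar_area_at K z \<le> (real n * sin (pi / n))\<^sup>2"
    "\<And>n. m \<le> n \<Longrightarrow> area K * polar_area_at K z = (real n * sin (pi / n))\<^sup>2 \<Longrightarrow>
      m = n \<and> (\<exists>f. linear f \<and> bij f \<and> (\<forall>i. v i - z = f (unit_vec (2 * pi * real i / real n))))"
proof -
  have tot: "total > 0" using assms total_pos by blast
  obtain z where z: "z \<in> Z" and bal: "(\<Sum>i<m. complex_of_real (dl z i) * cis (arg (Suc i) z)) = 0"
    using ex_balanced_point[OF tot] by blast
  obtain k where "mixed_area_form m (\<lambda>i. v i - z) (dl z) k" using mixed_area_form_at[OF z] ..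
  then interpret M: mixed_area_form m "\<lambda>i. v i - z" "dl z" k .
  have Md: "M.d i = e i z" for i by (simp add: M.d_def e_alt)
  define C S where "C i = cos (arg i z)" and "S i = sin (arg i z)" for i
  define x where "x i = e i z / total" for i
  have x_pos: "x i > 0" for i using e_pos[OF z, of i] tot by (simp add: x_def)
  have x_sum: "(\<Sum>i<m. x i) = 1"
    using tot by (simp add: x_def sum_divide_distrib[symmetric] sum_e[of z] total_def[symmetric])
  have per: "C (i + m) = C i" "S (i + m) = S i" for i
    using arg_periodic[OF tot, of i z] by (auto simp: C_def S_def complex_eq_iff)
  have balC: "(\<Sum>i<m. dl z i * C (Suc i)) = 0" 
    using arg_cong[OF bal, of Re] by (simp add: C_def)
  have balS: "(\<Sum>i<m. dl z i * S (Suc i)) = 0"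
    using arg_cong[OF bal, of Im] by (simp add: S_def)
  have nonneg: "M.B C C \<ge> 0" "M.B S S \<ge> 0" using per balC balS by (auto intro!: M.B_nonneg)
  have B: "M.B C C + M.B S S = 4 / total * (\<Sum>i<m. (sin (pi * x i))\<^sup>2 / x i) - (\<Sum>i<m. dl z i)"
  proof -
    have "M.B C C + M.B S S = (\<Sum>i<m. 4 / total * ((sin (pi * x i))\<^sup>2 / x i) - dl z i)"
      unfolding M.B_def sum.distrib[symmetric]
    proof (intro sum.cong refl)
      fix i
      have "(C (Suc i) - C i)\<^sup>2 + (S (Suc i) - S i)\<^sup>2 = 4 * (sin (pi * x i))\<^sup>2"
        unfolding C_def S_def norm_cis_diff_sq by (simp add: arg_Suc x_def)
      then have "(C (Suc i) - C i)\<^sup>2 / e i z + (S (Suc i) - S i)\<^sup>2 / e i z = 4 / total * ((sin (pi * x i))\<^sup>2 / x i)"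
        unfolding add_divide_distrib[symmetric] using tot e_pos[OF z, of i] by (simp add: x_def)
      moreover have "dl z i * (C (Suc i))\<^sup>2 + dl z i * (S (Suc i))\<^sup>2 = dl z i"
        unfolding distrib_left[symmetric] by (simp add: C_def S_def)
      ultimately show "(C (Suc i) - C i) * (C (Suc i) - C i) / M.d i - dl z i * C (Suc i) * C (Suc i) +
         ((S (Suc i) - S i) * (S (Suc i) - S i) / M.d i - dl z i * S (Suc i) * S (Suc i)) =
         4 / total * ((sin (pi * x i))\<^sup>2 / x i) - dl z i"
        unfolding Md power2_eq_square mult.assoc by linarith
    qed
    then show ?thesis by (simp add: sum_subtractf sum_distrib_left)
  qed
  have prod: "area K * polar_area_at K z = total * (\<Sum>i<m. dl z i) / 4"
    by (simp add: area_K[OF z] polar_area[OF z] total_def)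
  \<comment> \<open>A bounded sum minus a nonnegative deficit: attaining the bound forces equality
    in the tangent estimate and a zero deficit.\<close>
  have prod': "area K * polar_area_at K z = (\<Sum>i<m. (sin (pi * x i))\<^sup>2 / x i) - total / 4 * (M.B C C + M.B S S)"
    unfolding prod B using tot by (simp add: field_simps)
  have tB: "total / 4 * (M.B C C + M.B S S) \<ge> 0" using tot nonneg by simp
  have le: "(\<Sum>i<m. (sin (pi * x i))\<^sup>2 / x i) \<le> (real n * sin (pi / n))\<^sup>2" if "m \<le> n" for n
    by (rule sum_sin_sq_div_le(1)) (use that m_ge_3 x_pos x_sum in auto)
  have bound: "area K * polar_area_at K z \<le> (real n * sin (pi / n))\<^sup>2" if "m \<le> n" for n
    using le[OF that] tB unfolding prod' by linarith
  have equality: "m = n \<and> (\<exists>f. linear f \<and> bij f \<and> (\<forall>i. v i - z = f (unit_vec (2 * pi * real i / real n))))"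
    if mn: "m \<le> n" and eq: "area K * polar_area_at K z = (real n * sin (pi / n))\<^sup>2" for n
  proof -
    note le = le[OF mn]
    have "total / 4 * (M.B C C + M.B S S) = 0" using le tB eq unfolding prod' by linarith
    then have B0: "M.B C C = 0" "M.B S S = 0" using nonneg tot by auto
    have "(\<Sum>i<m. (sin (pi * x i))\<^sup>2 / x i) = (real n * sin (pi / n))\<^sup>2" using le tB eq unfolding prod' by linarith
    moreover have "3 \<le> n" using mn m_ge_3 by simp
    ultimately have "m = n" and xn: "\<forall>i<m. x i = 1 / n"
      using sum_sin_sq_div_le(2)[OF _ mn x_pos x_sum] by blast+
    define \<delta> where "\<delta> = total / n"
    have n0: "n > 0" using m_pos \<open>m = n\<close> by simp
    have \<delta>: "\<delta> > 0" using tot n0 by (simp add: \<delta>_def)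
    have en: "e i z = \<delta>" for i
      using xn[rule_format, of "i mod m"] m_pos tot by (simp add: x_def e_mod \<delta>_def field_simps)
    define \<alpha> where "\<alpha> = 2 * pi / n"
    have argn: "arg i z = real i * \<alpha>" for i
      using tot n0 by (simp add: arg_def en \<alpha>_def \<delta>_def)
    have \<alpha>: "0 < \<alpha>" "\<alpha> < pi" using m_ge_3 \<open>m = n\<close> by (auto simp: \<alpha>_def field_simps)
    then have sin\<alpha>: "sin \<alpha> > 0" by (intro sin_gt_zero) 
    \<comment> \<open>Compares zero defect with the recursion of equally spaced points on the
      circle; sine and cosine never vanish together, so the common factor must.\<close>
    have dl\<delta>: "dl z i * \<delta> = 2 - 2 * cos \<alpha>" for i
    proof -
      have defect: "M.defect y i = (2 * y (Suc i) - y i - y (Suc (Suc i))) / \<delta> - dl z i * y (Suc i)" for y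
        by (simp add: M.defect_def Md en diff_divide_distrib)
      have defC: "dl z i * \<delta> * C (Suc i) = 2 * C (Suc i) - C i - C (Suc (Suc i))"
        using M.B_eq_0_imp_defect_eq_0[OF per(1) balC B0(1), of i] \<delta> unfolding defect
        by (simp add: divide_eq_eq mult_ac)
      have defS: "dl z i * \<delta> * S (Suc i) = 2 * S (Suc i) - S i - S (Suc (Suc i))"
        using M.B_eq_0_imp_defect_eq_0[OF per(2) balS B0(2), of i] \<delta> unfolding defect
        by (simp add: divide_eq_eq mult_ac)
      have "real i * \<alpha> + 2 * \<alpha> = real (Suc (Suc i)) * \<alpha>" "real i * \<alpha> + \<alpha> = real (Suc i) * \<alpha>"
        by (auto simp: algebra_simps)
      then have rec: "C (Suc (Suc i)) = 2 * cos \<alpha> * C (Suc i) - C i" "S (Suc (Suc i)) = 2 * cos \<alpha> * S (Suc i) - S i"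
        using unit_vec_recursion[of "real i * \<alpha>" \<alpha>] 
        by (simp_all add: unit_vec_def vec_eq_iff forall_2 C_def S_def argn)
      have "(dl z i * \<delta> - (2 - 2 * cos \<alpha>)) * C (Suc i) = 0" "(dl z i * \<delta> - (2 - 2 * cos \<alpha>)) * S (Suc i) = 0"
        using defC defS unfolding rec by (auto simp: algebra_simps)
      moreover have "C (Suc i) \<noteq> 0 \<or> S (Suc i) \<noteq> 0" 
        using sin_zero_norm_cos_one[of "arg (Suc i) z"] by (auto simp: C_def S_def)
      ultimately show ?thesis by auto
    qed
    define p where "p i = v i - z" for i
    have rec: "p (Suc (Suc i)) = (2 * cos \<alpha>) *\<^sub>R p (Suc i) - p i" for i
    proof -
      have "(1 / \<delta>) *\<^sub>R ((p (Suc i) - p i) - (p (Suc (Suc i)) - p (Suc i))) = dl z i *\<^sub>R p (Suc i)"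
      proof -
        have dv: "p a - p b = v a - v b" for a b by (simp add: p_def)
        show ?thesis
          unfolding dv scaleR_diff_right[of _ "v (Suc i) - v i"] using recursion[OF z, of i] by (simp only: en p_def)
      qed
      then have "\<delta> *\<^sub>R ((1 / \<delta>) *\<^sub>R ((p (Suc i) - p i) - (p (Suc (Suc i)) - p (Suc i)))) = \<delta> *\<^sub>R (dl z i *\<^sub>R p (Suc i))"
        by simp
      then have "(p (Suc i) - p i) - (p (Suc (Suc i)) - p (Suc i)) = (2 - 2 * cos \<alpha>) *\<^sub>R p (Suc i)"
        using \<delta> dl\<delta>[of i] by (simp add: mult.commute)
      then show ?thesis by (simp add: scaleR_diff_left scaleR_2 algebra_simps)
    qed
    have "cr (p 0) (p 1) \<noteq> 0" using e_pos[OF z, of 0] by (simp add: p_def e_alt)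
    then obtain f where "linear f" "bij f" "\<And>i. p i = f (unit_vec (real i * \<alpha>))"
      using linear_image_if_same_recursion[of p \<alpha>] rec sin\<alpha> by auto
    then show ?thesis using \<open>m = n\<close> by (auto simp: p_def \<alpha>_def mult_ac)
  qed
  show thesis by (rule that[OF z bound equality])
qed

end

section \<open>Ordering the vertices of a polytope\<close>

lemma ex_strict_mono_enumeration:
  fixes key :: "'a \<Rightarrow> real"
  assumes "finite F" "inj_on key F"
  obtains g where "g ` {..<card F} = F" "\<And>i j. i < j \<Longrightarrow> j < card F \<Longrightarrow> key (g i) < key (g j)"
proof -
  define L where "L = sorted_list_of_set (key ` F)"
  have L: "length L = card F" "set L = key ` F" "sorted L" "distinct L"
    using assms by (auto simp: L_def card_image)
  define g where "g i = inv_into F key (L ! i)" for i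
  have "(\<lambda>i. L ! i) ` {..<card F} = key ` F"
    using L by (auto simp: set_conv_nth image_def)
  moreover have "g ` {..<card F} = inv_into F key ` ((\<lambda>i. L ! i) ` {..<card F})"
    unfolding image_image g_def[abs_def] ..
  ultimately have 1: "g ` {..<card F} = F" using assms by simp
  have "key (g i) = L ! i" if "i < card F" for i
  proof -
    have "L ! i \<in> key ` F" using that L nth_mem[of i L] by simp
    then show ?thesis unfolding g_def by (rule f_inv_into_f)
  qed
  then have "key (g i) < key (g j)" if "i < j" "j < card F" for i j
    using that L sorted_nth_mono[of L i j] nth_eq_iff_index_eq[of L i j] by (simp add: less_le)
  then show thesis using that 1 by blast
qed

lemma extreme_point_not_in_hull:
  assumes "convex K" "x extreme_point_of K" "S \<subseteq> K" "x \<notin> S"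
  shows "x \<notin> convex hull S"
proof -
  have "convex (K - {x})" using assms extreme_point_of_stillconvex by blast
  then have "convex hull S \<subseteq> K - {x}" using assms by (intro hull_minimal) auto
  then show ?thesis by auto
qed

text \<open>Start at a vertex farthest from the origin: the other ones lie in an open half-plane as seen
  from there, so they are ordered by slope.\<close>
theorem polytope_vertices_ccw:
  fixes K :: "(real^2) set"
  assumes "polytope K" "interior K \<noteq> {}"
  obtains v where "ccw_polygon (card {x. x extreme_point_of K}) v" 
    "convex hull (v ` {..<card {x. x extreme_point_of K}}) = K"
proof -
  define E where "E = {x. x extreme_point_of K}"
  obtain V where V: "finite V" "K = convex hull V" using assms by (auto simp: polytope_def)
  have finE: "finite E" unfolding E_def V(2) 
    using V(1) extreme_points_of_convex_hull finite_subset by blast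
  have KE: "K = convex hull E" using Krein_Milman_polytope[OF V(1)] V(2) by (simp add: E_def)
  have EK: "E \<subseteq> K" by (auto simp: E_def extreme_point_of_def)
  have convK: "convex K" using KE by simp
  define m where "m = card E"
  have m3: "m \<ge> 3"
  proof -
    have "aff_dim K = 2" using aff_dim_nonempty_interior[OF assms(2)] by simp
    then have "aff_dim E = 2" using KE by (simp add: aff_dim_convex_hull)
    then show ?thesis using aff_dim_le_card[OF finE] by (simp add: m_def)
  qed
  then have "E \<noteq> {}" by (auto simp: m_def)
  then obtain v0 where v0: "v0 \<in> E" "\<And>a. a \<in> E \<Longrightarrow> norm a \<le> norm v0"
  proof -
    have "Max (norm ` E) \<in> norm ` E" using finE \<open>E \<noteq> {}\<close> by simp
    then obtain x where "x \<in> E" "norm x = Max (norm ` E)" by auto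
    moreover have "norm a \<le> Max (norm ` E)" if "a \<in> E" for a using finE that by simp
    ultimately show thesis using that by metis
  qed
  define F where "F = E - {v0}"
  have F: "a \<in> E" "a \<noteq> v0" if "a \<in> F" for a using that by (auto simp: F_def)
  have cardF: "card F = m - 1" "finite F" using finE v0 by (auto simp: F_def m_def)
  have P: "v0 \<bullet> (v0 - a) > 0" if "a \<in> F" for a
  proof -
    have "0 < (norm (v0 - a))\<^sup>2" using F[OF that] by auto
    also have "\<dots> = (norm v0)\<^sup>2 + (norm a)\<^sup>2 - 2 * (v0 \<bullet> a)"
      by (simp add: power2_norm_eq_inner inner_diff_left inner_diff_right inner_commute)
    also have "\<dots> \<le> 2 * ((norm v0)\<^sup>2 - v0 \<bullet> a)"
      using power_mono[OF v0(2)[OF F(1)[OF that]], of 2] by simp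
    finally show ?thesis by (simp add: inner_diff_right power2_norm_eq_inner)
  qed
  have "F \<noteq> {}" using cardF m3 by auto
  then have v00: "v0 \<bullet> v0 > 0" using P by fastforce
  \<comment> \<open>The tangent of the angle from \<open>v0\<close> to \<open>v0 - a\<close>; by
    \<open>P\<close> this angle is acute, so the key orders the directions.\<close>
  define key where "key a = cr v0 (v0 - a) / (v0 \<bullet> (v0 - a))" for a
  have ident: "cr v0 (v0 - b) * (v0 \<bullet> (v0 - a)) - cr v0 (v0 - a) * (v0 \<bullet> (v0 - b)) = (v0 \<bullet> v0) * orient v0 a b" for a b
    by (simp add: orient_def cr_def inner_vec_def sum_2 algebra_simps)
  have key_less: "key a < key b \<longleftrightarrow> orient v0 a b > 0" if "a \<in> F" "b \<in> F" for a b
  proof -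
    have "key a < key b \<longleftrightarrow> cr v0 (v0 - b) * (v0 \<bullet> (v0 - a)) - cr v0 (v0 - a) * (v0 \<bullet> (v0 - b)) > 0"
      using P[OF that(1)] P[OF that(2)] by (simp add: key_def field_simps)
    then show ?thesis unfolding ident using v00 by (simp add: zero_less_mult_iff)
  qed
  \<comment> \<open>Equal slopes make \<open>v0 - a\<close> and \<open>v0 - b\<close> point the same
    way, and the vertex nearer to \<open>v0\<close> would lie on the segment from \<open>v0\<close>
    to the other.\<close>
  have inj: "inj_on key F"
  proof (rule inj_onI, rule ccontr)
    have *: False if "a \<in> F" "b \<in> F" "a \<noteq> b" "v0 - b = t *\<^sub>R (v0 - a)" "0 \<le> t" "t \<le> 1" for a b t
    proof -
      have "b = (1 - t) *\<^sub>R v0 + t *\<^sub>R a" using that(4) by (simp add: algebra_simps)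
      then have "b \<in> convex hull {v0, a}"
        using that(5,6) unfolding segment_convex_hull[symmetric] in_segment by blast
      then show False using extreme_point_not_in_hull[of K b "{v0, a}"] that F v0(1) EK convK by (auto simp: E_def)
    qed
    fix a b assume ab: "a \<in> F" "b \<in> F" "key a = key b" "a \<noteq> b"
    have "orient v0 a b = 0"
      using ident[of b a] P[OF ab(1)] P[OF ab(2)] v00 ab(3) by (simp add: key_def field_simps)
    then have c: "cr (v0 - a) (v0 - b) = 0" by (simp add: orient_def cr_def algebra_simps)
    have e: "(v0 \<bullet> (v0 - a)) *\<^sub>R (v0 - b) = (v0 \<bullet> (v0 - b)) *\<^sub>R (v0 - a)"
      using c by (simp add: cr_def vec_eq_iff forall_2 inner_vec_def sum_2) algebra
    have scale: "y = (s / r) *\<^sub>R x" if "r *\<^sub>R y = s *\<^sub>R x" "r > 0" for r s :: real and x y :: "real^2"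
      using arg_cong[OF that(1), of "\<lambda>w. (1 / r) *\<^sub>R w"] that(2) by simp
    show False
    proof (cases "v0 \<bullet> (v0 - b) \<le> v0 \<bullet> (v0 - a)")
      case True
      then show False using *[OF ab(1,2,4) scale[OF e P[OF ab(1)]]] P[OF ab(1)] P[OF ab(2)] by simp
    next
      case False
      then show False using *[OF ab(2,1) ab(4)[symmetric] scale[OF e[symmetric] P[OF ab(2)]]] P[OF ab(1)] P[OF ab(2)] by simp
    qed
  qed
  obtain g where g: "g ` {..<card F} = F" "\<And>i j. i < j \<Longrightarrow> j < card F \<Longrightarrow> key (g i) < key (g j)"
    using ex_strict_mono_enumeration[OF cardF(2) inj] by blast
  define v where "v i = (if i mod m = 0 then v0 else g (i mod m - 1))" for i
  have vF: "v i \<in> F" if "0 < i" "i < m" for i using that g(1) cardF by (auto simp: v_def)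
  have o0: "orient v0 (v i) (v j) > 0" if "0 < i" "i < j" "j < m" for i j
    using key_less[OF vF vF, of i j] g(2)[of "i - 1" "j - 1"] that cardF by (simp add: v_def)
  have "ccw_polygon m v"
  proof
    show "v (i + m) = v i" for i by (simp add: v_def)
    show "0 < orient (v i) (v j) (v l)" if l: "i < j" "j < l" "l < m" for i j l
    proof (cases "i = 0")
      case True
      then show ?thesis using o0 l by (simp add: v_def)
    next
      case False
      define a b c where "a = v i - v0" and "b = v j - v0" and "c = v l - v0"
      have ab: "cr a b > 0" and bc: "cr b c > 0" and ac: "cr a c > 0"
        using o0[of i j] o0[of j l] o0[of i l] False l by (auto simp: orient_def a_def b_def c_def)
      show ?thesis
      proof (rule ccontr)
        assume "\<not> ?thesis"
        \<comment> \<open>Without a strict left turn \<open>v j\<close> would be in the triangle of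
          \<open>v0\<close>, \<open>v i\<close>, \<open>v l\<close>: its coordinates \<alpha>,
          \<beta> are positive with sum at most 1.\<close>
        then have le: "cr b c + cr a b \<le> cr a c" by (simp add: orient_def a_def b_def c_def cr_def algebra_simps)
        define \<alpha> \<beta> where "\<alpha> = cr b c / cr a c" and "\<beta> = cr a b / cr a c"
        have "b = \<alpha> *\<^sub>R a + \<beta> *\<^sub>R c" "\<alpha> \<ge> 0" "\<beta> \<ge> 0" "\<alpha> + \<beta> \<le> 1"
          using cr_coordinates[of a c b] ab bc ac le
          by (auto simp: \<alpha>_def \<beta>_def add_divide_distrib[symmetric])
        then have "b \<in> convex hull {0, a, c}" unfolding convex_hull_0_2 by blast
        then have "v0 + b \<in> (+) v0 ` (convex hull {0, a, c})" by blast
        also have "\<dots> = convex hull ((+) v0 ` {0, a, c})" by (rule convex_hull_translation[symmetric])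
        also have "(+) v0 ` {0, a, c} = {v0, v i, v l}" by (simp add: a_def c_def)
        finally have "v j \<in> convex hull {v0, v i, v l}" by (simp add: b_def)
        moreover have "v j \<notin> {v0, v i, v l}" 
        proof -
          have "b \<noteq> 0" "b \<noteq> a" "b \<noteq> c" using ab bc by (auto simp: cr_algebra)
          then show ?thesis by (auto simp: a_def b_def c_def)
        qed
        moreover have "{v0, v i, v l} \<subseteq> K" "v j extreme_point_of K"
          using vF F v0 EK False l unfolding E_def by auto
        ultimately show False using extreme_point_not_in_hull convK by blast
      qed
    qed
  qed (use m3 in auto)
  moreover have "v ` {..<m} = E"
  proof -
    have "m = Suc (card F)" using m3 cardF by simp
    then have "{..<m} = insert 0 (Suc ` {..<card F})" by (simp add: lessThan_Suc_eq_insert_0)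
    moreover have "v ` Suc ` {..<card F} = g ` {..<card F}"
      unfolding image_image by (intro image_cong) (use cardF in \<open>auto simp: v_def\<close>)
    ultimately show ?thesis using g(1) v0(1) by (simp add: v_def F_def insert_absorb)
  qed
  ultimately have "ccw_polygon m v" "convex hull (v ` {..<m}) = K" using KE by auto
  then show thesis by (rule that[folded E_def, folded m_def])
qed

section \<open>Regular polygons\<close>

lemma linear_cr:
  fixes f :: "real^2 \<Rightarrow> real^2"
  assumes "linear f"
  shows "cr (f x) (f y) = cr (f (vector [1, 0])) (f (vector [0, 1])) * cr x y"
proof -
  have f: "f x = (x $ 1) *\<^sub>R f (vector [1, 0]) + (x $ 2) *\<^sub>R f (vector [0, 1])" for x
  proof -
    have "x = (x $ 1) *\<^sub>R vector [1, 0] + (x $ 2) *\<^sub>R vector [0, 1]" by (simp add: vec_eq_iff forall_2)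
    then have "f x = f ((x $ 1) *\<^sub>R vector [1, 0] + (x $ 2) *\<^sub>R vector [0, 1])" by simp
    then show ?thesis by (simp only: linear_add[OF assms] linear_scale[OF assms])
  qed
  show ?thesis unfolding f[of x] f[of y] cr_algebra by (simp add: cr_swap[of "f (vector [0, 1])"])
    (simp add: cr_def algebra_simps)
qed

lemma linear_orient:
  assumes "linear f"
  shows "orient (f x) (f y) (f z) = cr (f (vector [1, 0])) (f (vector [0, 1])) * orient x y z"
  by (simp add: orient_def linear_cr[OF assms, symmetric] linear_diff[OF assms])

text \<open>Twice the classical area 2 sin A sin B sin C of a triangle in the unit circle. The
  product form shows the sign for all ordered triples at once.\<close>

lemma orient_unit_vec:
  "orient (unit_vec s) (unit_vec t) (unit_vec u) = 4 * sin ((t - s) / 2) * sin ((u - t) / 2) * sin ((u - s) / 2)"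
proof -
  define a b where "a = (t - s) / 2" and "b = (u - t) / 2"
  have "orient (unit_vec s) (unit_vec t) (unit_vec u) = sin (t - s) + sin (u - t) - sin (u - s)"
    using sin_minus[of "t - s"] by (simp add: orient_def cr_algebra cr_unit_vec)
  also have "\<dots> = sin (2 * a) + sin (2 * b) - sin (2 * a + 2 * b)"
  proof -
    have "t - s = 2 * a" "u - t = 2 * b" "u - s = 2 * a + 2 * b"
      by (simp_all add: a_def b_def field_simps)
    then show ?thesis by (simp only:)
  qed
  also have "sin (2 * a) + sin (2 * b) - sin (2 * a + 2 * b) = sin (2 * a) * (1 - cos (2 * b)) + sin (2 * b) * (1 - cos (2 * a))"
    by (simp add: sin_add algebra_simps)
  also have "\<dots> = 4 * sin a * sin b * sin (a + b)"
    by (simp only: sin_double cos_double_sin sin_add) (simp add: power2_eq_square algebra_simps)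
  also have "a + b = (u - s) / 2" by (simp add: a_def b_def field_simps)
  finally show ?thesis by (simp only: a_def b_def)
qed

text \<open>Reduces maps of negative determinant to positive ones, as \<open>ccw_polygon\<close>
  demands positive orientation.\<close>

lemma regular_polygon_reflect:
  assumes "n > 0"
  defines "R \<equiv> (\<lambda>x :: real^2. vector [x $ 1, - x $ 2] :: real^2)"
  shows "R ` regular_polygon n r \<theta> = regular_polygon n r (- \<theta>)" "linear R" "bij R"
proof -
  show lin: "linear R" by (rule linearI) (auto simp: R_def vec_eq_iff forall_2)
  have RR: "R (R x) = x" for x by (simp add: R_def vec_eq_iff forall_2)
  then show "bij R" by (rule involuntory_imp_bij)
  define p where "p \<theta> k = r *\<^sub>R unit_vec (\<theta> + 2 * pi * real k / real n)" for \<theta> k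
  have "R (p \<theta> k) \<in> p (- \<theta>) ` {..<n}" if k: "k < n" for k \<theta>
  proof (cases "k = 0")
    case True
    then show ?thesis using assms by (intro image_eqI[of _ _ 0]) (auto simp: p_def R_def unit_vec_def vec_eq_iff forall_2)
  next
    case False
    have "- \<theta> + 2 * pi * real (n - k) / real n = - (\<theta> + 2 * pi * real k / real n) + 2 * pi"
      using k by (simp add: of_nat_diff field_simps)
    moreover have "R (r *\<^sub>R unit_vec y) = r *\<^sub>R unit_vec (- y + 2 * pi)" for y
      by (simp add: R_def unit_vec_def vec_eq_iff forall_2)
    ultimately have "R (p \<theta> k) = p (- \<theta>) (n - k)" by (simp only: p_def)
    then show ?thesis using False k by auto
  qed
  then have sub: "R ` p \<theta> ` {..<n} \<subseteq> p (- \<theta>) ` {..<n}" for \<theta> by auto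
  have "p (- \<theta>) ` {..<n} = R ` R ` p (- \<theta>) ` {..<n}" by (simp add: image_image RR)
  also have "\<dots> \<subseteq> R ` p \<theta> ` {..<n}" using sub[of "- \<theta>"] by (intro image_mono) simp
  finally have "R ` p \<theta> ` {..<n} = p (- \<theta>) ` {..<n}" using sub by blast
  then show "R ` regular_polygon n r \<theta> = regular_polygon n r (- \<theta>)"
    unfolding regular_polygon_eq p_def[symmetric] by (simp add: convex_hull_linear_image[OF lin])
qed

text \<open>The left-hand side is the tangent plane of \<open>1 / (x * y)\<close> at the point with
  both coordinates \<open>d\<close>. After scaling by \<open>d\<close>, and for X + Y < 3, the claim
  is the AM-GM inequality for X, Y and 3 - X - Y.\<close>

lemma am_gm_inverse:
  fixes x y d :: real
  assumes "x > 0" "y > 0" "d > 0"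
  shows "3 / d\<^sup>2 - (x + y) / d ^ 3 \<le> 1 / (x * y)"
    and "x \<noteq> d \<Longrightarrow> 3 / d\<^sup>2 - (x + y) / d ^ 3 < 1 / (x * y)"
proof -
  define X Y where "X = x / d" and "Y = y / d"
  have XY: "X > 0" "Y > 0" and x: "x = d * X" "y = d * Y" using assms by (auto simp: X_def Y_def)
  have eq: "1 / (x * y) - (3 / d\<^sup>2 - (x + y) / d ^ 3) = (X * Y * (X + Y - 3) + 1) / (d\<^sup>2 * (X * Y))"
    unfolding x using XY assms(3) by (simp add: field_simps power2_eq_square power3_eq_cube)
  have id: "4 * (X * Y * (X + Y - 3) + 1) = (X + Y - 2)\<^sup>2 * (X + Y + 1) + (3 - (X + Y)) * (X - Y)\<^sup>2"
    by (simp add: power2_eq_square algebra_simps)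
  have pos: "X * Y * (X + Y - 3) + 1 > 0" if "X + Y \<ge> 3" using that XY by (simp add: add_nonneg_pos)
  have nonneg: "(X + Y - 2)\<^sup>2 * (X + Y + 1) \<ge> 0" using XY by simp
  have "X * Y * (X + Y - 3) + 1 \<ge> 0"
  proof (cases "X + Y \<ge> 3")
    case False
    then have "(3 - (X + Y)) * (X - Y)\<^sup>2 \<ge> 0" by simp
    with nonneg have "4 * (X * Y * (X + Y - 3) + 1) \<ge> 0" unfolding id by (rule add_nonneg_nonneg)
    then show ?thesis by simp
  qed (use pos in simp)
  then have "(X * Y * (X + Y - 3) + 1) / (d\<^sup>2 * (X * Y)) \<ge> 0" using XY assms(3) by simp
  then show "3 / d\<^sup>2 - (x + y) / d ^ 3 \<le> 1 / (x * y)" using eq by linarith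
  assume "x \<noteq> d"
  then have X1: "X \<noteq> 1" using assms by (simp add: X_def)
  have "X * Y * (X + Y - 3) + 1 > 0"
  proof (cases "X + Y \<ge> 3")
    case False
    have "0 < (X + Y - 2)\<^sup>2 * (X + Y + 1) + (3 - (X + Y)) * (X - Y)\<^sup>2"
    proof (cases "X = Y")
      case True
      then show ?thesis using X1 XY by simp
    next
      case F: False
      then have "(3 - (X + Y)) * (X - Y)\<^sup>2 > 0" using False by simp
      with nonneg show ?thesis by (rule add_nonneg_pos)
    qed
    then have "4 * (X * Y * (X + Y - 3) + 1) > 0" unfolding id .
    then show ?thesis by simp
  qed (use pos in simp)
  then have "(X * Y * (X + Y - 3) + 1) / (d\<^sup>2 * (X * Y)) > 0" using XY assms(3) by simp
  then show "3 / d\<^sup>2 - (x + y) / d ^ 3 < 1 / (x * y)" using eq by linarith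
qed

lemma polar_area_at_0: "polar_area_at K 0 = area (polar_body K)"
  by (simp add: polar_area_at_def)

text \<open>All \<open>e i 0\<close> agree and so do all \<open>a i\<close>; the polar area at
  \<open>w\<close> is thus a constant times the sum of the \<open>1 / (e i w * e (Suc i) w)\<close>,
  while the sum of the \<open>e i w\<close> is fixed. Tangent planes at the common value
  \<open>d\<close> single out the origin as the minimizer.\<close>

lemma positive_linear_image_regular_polygon:
  fixes f :: "real^2 \<Rightarrow> real^2" and r \<theta> :: real and n :: nat
  assumes n: "n \<ge> 3" and r: "r > 0" and lin: "linear f" and det: "cr (f (vector [1, 0])) (f (vector [0, 1])) > 0"
  defines "L \<equiv> f ` regular_polygon n r \<theta>"
  shows "L \<in> santalo_centred_polygons n" "area_product L = (real n * sin (pi / n))\<^sup>2"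
proof -
  define \<Delta> where "\<Delta> = cr (f (vector [1, 0])) (f (vector [0, 1])) * r\<^sup>2"
  have \<Delta>: "\<Delta> > 0" using det r by (simp add: \<Delta>_def)
  define v where "v i = f (r *\<^sub>R unit_vec (\<theta> + 2 * pi * real i / real n))" for i
  define h where "h = pi / n"
  have h: "0 < h" "h \<le> pi / 3" using n by (auto simp: h_def field_simps)
  have sin_h: "sin h > 0" "sin (2 * h) > 0" using h by (auto intro!: sin_gt_zero)
  have scale: "orient (r *\<^sub>R x) (r *\<^sub>R y) (r *\<^sub>R z) = r\<^sup>2 * orient x y z" for x y z
    by (simp add: orient_def cr_def power2_eq_square algebra_simps)
  have orient_v: "orient (v i) (v j) (v l) = \<Delta> * (4 * sin ((real j - real i) * h) * sin ((real l - real j) * h) * sin ((real l - real i) * h))" for i j l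
  proof -
    have "((\<theta> + 2 * pi * real j / real n) - (\<theta> + 2 * pi * real i / real n)) / 2 = (real j - real i) * h" for i j
      by (simp add: h_def diff_divide_distrib algebra_simps)
    then show ?thesis unfolding v_def linear_orient[OF lin] scale orient_unit_vec by (simp add: \<Delta>_def)
  qed
  interpret ccw_polygon n v
  proof
    show "v (i + n) = v i" for i
    proof -
      have "\<theta> + 2 * pi * real (i + n) / real n = (\<theta> + 2 * pi * real i / real n) + 2 * pi"
        using n by (simp add: field_simps)
      then show ?thesis by (simp only: v_def unit_vec_def) simp
    qed
    show "0 < orient (v i) (v j) (v l)" if "i < j" "j < l" "l < n" for i j l
    proof -
      have "sin ((real b - real a) * h) > 0" if "a < b" "b < n" for a b
      proof (rule sin_gt_zero)
        show "0 < (real b - real a) * h" using that h by simp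
        have "(real b - real a) * h < real n * h" using that h by (intro mult_strict_right_mono) auto
        then show "(real b - real a) * h < pi" using n by (simp add: h_def)
      qed
      then show ?thesis using that \<Delta> by (simp add: orient_v)
    qed
  qed (use n in auto)
  have KL: "K = L"
    by (simp add: K_def L_def regular_polygon_eq convex_hull_linear_image[OF lin] image_image v_def)
  have f0: "f 0 = 0" using lin by (rule linear_0)
  have e0: "e i 0 = \<Delta> * sin (2 * h)" for i
  proof -
    have "(\<theta> + 2 * pi * real (Suc i) / real n) - (\<theta> + 2 * pi * real i / real n) = 2 * h"
      using n by (simp add: h_def field_simps)
    then show ?thesis
      by (simp add: e_alt v_def linear_cr[OF lin, of "r *\<^sub>R _"] cr_algebra cr_unit_vec \<Delta>_def power2_eq_square)
  qed
  define d where "d = \<Delta> * sin (2 * h)"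
  have d: "d > 0" using \<Delta> sin_h by (simp add: d_def)
  have ai: "a i = d * (4 * (sin h)\<^sup>2)" for i
  proof -
    have 2: "real (Suc (Suc i)) - real i = 2" "real (Suc (Suc i)) - real (Suc i) = 1" "real (Suc i) - real i = 1" by auto
    show ?thesis unfolding a_def orient_v 2 by (simp add: d_def power2_eq_square)
  qed
  have Z0: "0 \<in> Z" using d by (simp add: Z_def e0 d_def)
  have sum_e_d: "(\<Sum>i<n. e i w) = n * d" for w
    unfolding sum_e[of w] by (simp add: e0 d_def)
  have dl0: "dl 0 i = d * (4 * (sin h)\<^sup>2) / d\<^sup>2" for i
    by (simp add: dl_def ai e0 d_def power2_eq_square)
  have area_L: "area L = n * d / 2" using area_K[OF Z0] sum_e_d[of 0] by (simp add: KL)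
  have polar0: "polar_area_at L 0 = n * (d * (4 * (sin h)\<^sup>2) / d\<^sup>2) / 2"
    using polar_area[OF Z0] by (simp add: KL dl0)
  show "area_product L = (real n * sin (pi / n))\<^sup>2"
    unfolding area_product_def polar_area_at_0[symmetric] area_L polar0 h_def[symmetric]
    using d by (simp add: power2_eq_square field_simps)
  have strict: "polar_area_at L 0 < polar_area_at L w" if w: "w \<in> Z" "w \<noteq> 0" for w
  proof -
    define A where "A = d * (4 * (sin h)\<^sup>2)"
    have A: "A > 0" using d sin_h by (simp add: A_def)
    \<comment> \<open>Edges 0 and 1 are not parallel, so the values of \<open>e 0\<close> and
      \<open>e 1\<close> already determine the point.\<close>
    have "\<exists>i<n. e i w \<noteq> d"
    proof (rule ccontr)
      assume "\<not> ?thesis"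
      then have "e i w = e i 0" if "i < n" for i using that by (auto simp: e0 d_def)
      then have "e 0 w = e 0 0" "e 1 w = e 1 0" using n by auto
      then have c: "cr (v 1 - v 0) w = 0" "cr (v 2 - v 1) w = 0"
        by (auto simp: e_alt cr_def algebra_simps numeral_2_eq_2)
      have "cr (v 1 - v 0) (v 2 - v 1) = a 0"
        by (simp add: a_def orient_def cr_def algebra_simps numeral_2_eq_2)
      then have "a 0 *\<^sub>R w = 0"
        using cr_plucker[of "v 1 - v 0" "v 2 - v 1" w] c cr_swap[of w "v 1 - v 0"] by simp
      then show False using a_pos[of 0] w by simp
    qed
    then obtain i0 where i0: "i0 < n" "e i0 w \<noteq> d" by blast
    have "(\<Sum>i<n. 3 / d\<^sup>2 - (e i w + e (Suc i) w) / d ^ 3) < (\<Sum>i<n. 1 / (e i w * e (Suc i) w))"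
      using i0 am_gm_inverse[OF e_pos[OF w(1)] e_pos[OF w(1)] d]
      by (intro sum_strict_mono_ex1 bexI[of _ i0]) auto
    also have "(\<Sum>i<n. 3 / d\<^sup>2 - (e i w + e (Suc i) w) / d ^ 3) = n * (3 / d\<^sup>2) - ((\<Sum>i<n. e i w) + (\<Sum>i<n. e (Suc i) w)) / d ^ 3"
      by (simp add: sum_subtractf sum.distrib sum_divide_distrib[symmetric])
    also have "(\<Sum>i<n. e (Suc i) w) = (\<Sum>i<n. e i w)"
      by (rule sum_lessThan_shift_periodic) (rule e_m)
    also have "n * (3 / d\<^sup>2) - ((\<Sum>i<n. e i w) + (\<Sum>i<n. e i w)) / d ^ 3 = n / d\<^sup>2"
      unfolding sum_e_d using d by (simp add: field_simps power2_eq_square power3_eq_cube)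
    finally have "A * (n / d\<^sup>2) < A * (\<Sum>i<n. 1 / (e i w * e (Suc i) w))"
      using A by (rule mult_strict_left_mono)
    moreover have "polar_area_at L w = A * (\<Sum>i<n. 1 / (e i w * e (Suc i) w)) / 2"
      using polar_area[OF w(1)] by (simp add: KL dl_def ai A_def sum_distrib_left)
    moreover have "polar_area_at L 0 = A * (n / d\<^sup>2) / 2"
      unfolding polar0 A_def by simp
    ultimately show ?thesis by simp
  qed
  have ext: "{x. x extreme_point_of L} \<subseteq> v ` {..<n}"
    unfolding KL[symmetric] K_def by (rule extreme_points_of_convex_hull)
  then have "card {x. x extreme_point_of L} \<le> card (v ` {..<n})" by (intro card_mono) auto
  also have "\<dots> \<le> n" using card_image_le[of "{..<n}" v] by simp
  finally have "card {x. x extreme_point_of L} \<le> n" .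
  moreover have "polytope L" unfolding KL[symmetric] K_def polytope_def by blast
  moreover have "interior L = Z" using interior_K KL by simp
  ultimately show "L \<in> santalo_centred_polygons n"
    using Z0 strict by (auto simp: santalo_centred_polygons_def is_santalo_point_def)
qed

lemma linear_image_regular_polygon:
  fixes f :: "real^2 \<Rightarrow> real^2"
  assumes n: "n \<ge> 3" and r: "r > 0" and f: "linear f" "bij f"
  shows "f ` regular_polygon n r \<theta> \<in> santalo_centred_polygons n"
    and "area_product (f ` regular_polygon n r \<theta>) = (real n * sin (pi / n))\<^sup>2"
proof -
  define D where "D = cr (f (vector [1, 0])) (f (vector [0, 1]))"
  have "D \<noteq> 0"
  proof
    assume "D = 0"
    then have z: "cr x y = 0" for x y
      using linear_cr[OF f(1), of "inv f x" "inv f y"] f(2) by (simp add: D_def bij_is_surj surj_f_inv_f)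
    show False using z[of "vector [1, 0]" "vector [0, 1]"] by (simp add: cr_def)
  qed
  have "f ` regular_polygon n r \<theta> \<in> santalo_centred_polygons n
    \<and> area_product (f ` regular_polygon n r \<theta>) = (real n * sin (pi / n))\<^sup>2"
  proof (cases "D > 0")
    case True
    then show ?thesis using positive_linear_image_regular_polygon[OF n r f(1)] by (simp add: D_def)
  next
    case False
    define R where "R = (\<lambda>x :: real^2. vector [x $ 1, - x $ 2] :: real^2)"
    have lin: "linear (f \<circ> R)"
      using regular_polygon_reflect(2)[of n, folded R_def] f n by (auto intro: linear_compose)
    have R1: "R (vector [1, 0]) = vector [1, 0]" and R2: "R (vector [0, 1]) = - vector [0, 1]"
      by (auto simp: R_def vec_eq_iff forall_2)
    have "cr ((f \<circ> R) (vector [1, 0])) ((f \<circ> R) (vector [0, 1])) = - D"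
      by (simp add: R1 R2 linear_neg[OF f(1)] cr_algebra D_def)
    then have "cr ((f \<circ> R) (vector [1, 0])) ((f \<circ> R) (vector [0, 1])) > 0" using False \<open>D \<noteq> 0\<close> by simp
    moreover have "f ` regular_polygon n r \<theta> = (f \<circ> R) ` regular_polygon n r (- \<theta>)"
      using regular_polygon_reflect(1)[of n r "- \<theta>", folded R_def] n unfolding image_comp[symmetric] by simp
    ultimately show ?thesis using positive_linear_image_regular_polygon[OF n r lin] by simp
  qed
  then show "f ` regular_polygon n r \<theta> \<in> santalo_centred_polygons n"
    and "area_product (f ` regular_polygon n r \<theta>) = (real n * sin (pi / n))\<^sup>2" by auto
qed

theorem area_product_le:
  assumes n: "n \<ge> 3" and L: "L \<in> santalo_centred_polygons n"
  shows "area_product L \<le> (real n * sin (pi / n))\<^sup>2"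
    and "area_product L = (real n * sin (pi / n))\<^sup>2 \<Longrightarrow> \<exists>f. linear f \<and> bij f \<and> L = f ` regular_polygon n 1 0"
proof -
  define m where "m = card {x. x extreme_point_of L}"
  have L': "polytope L" "interior L \<noteq> {}" "m \<le> n" "0 \<in> interior L"
    "\<And>w. w \<in> interior L \<Longrightarrow> w \<noteq> 0 \<Longrightarrow> polar_area_at L 0 < polar_area_at L w"
    using L by (auto simp: santalo_centred_polygons_def is_santalo_point_def m_def)
  obtain v where v: "ccw_polygon m v" "convex hull (v ` {..<m}) = L"
    using polytope_vertices_ccw[OF L'(1,2)] unfolding m_def by blast
  interpret ccw_polygon m v by (rule v(1))
  have KL: "K = L" using v(2) by (simp add: K_def)
  have ZL: "Z = interior L" using interior_K KL by simp
  obtain z where z: "z \<in> Z" 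
    and bd: "\<And>n. m \<le> n \<Longrightarrow> area K * polar_area_at K z \<le> (real n * sin (pi / n))\<^sup>2"
    and eq: "\<And>n. m \<le> n \<Longrightarrow> area K * polar_area_at K z = (real n * sin (pi / n))\<^sup>2 \<Longrightarrow>
      m = n \<and> (\<exists>f. linear f \<and> bij f \<and> (\<forall>i. v i - z = f (unit_vec (2 * pi * real i / real n))))"
    using area_product_bound L'(2) unfolding ZL[symmetric] by blast
  have area_pos: "area L > 0" using area_K[OF z] total_pos[OF z] by (simp add: KL total_def)
  have product: "area_product L = area L * polar_area_at L 0"
    by (simp add: area_product_def polar_area_at_0)
  \<comment> \<open>The balanced point \<open>z\<close> may differ from the origin, but then strict
    minimality at 0 puts the product strictly below the bound; so equality forces
    \<open>z = 0\<close>.\<close>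
  have less: "area_product L < area L * polar_area_at L z" if "z \<noteq> 0"
    unfolding product using area_pos L'(5)[of z] z that by (simp add: ZL)
  then show "area_product L \<le> (real n * sin (pi / n))\<^sup>2"
    using bd[OF L'(3)] product by (cases "z = 0") (auto simp: KL)
  assume e: "area_product L = (real n * sin (pi / n))\<^sup>2"
  then have z0: "z = 0" using less bd[OF L'(3)] by (force simp: KL)
  then obtain f where f: "m = n" "linear f" "bij f" "\<And>i. v i = f (unit_vec (2 * pi * real i / real n))"
    using eq[OF L'(3)] e product by (auto simp: KL)
  have "L = f ` regular_polygon n 1 0"
    unfolding v(2)[symmetric] regular_polygon_eq convex_hull_linear_image[OF f(2)] image_image f(1)
    by (simp add: f(4))
  then show "\<exists>f. linear f \<and> bij f \<and> L = f ` regular_polygon n 1 0" using f by blast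
qed

theorem theoremF:
  fixes n :: nat
  assumes "n \<ge> 3"
  shows "{K \<in> santalo_centred_polygons n.
            \<forall>L \<in> santalo_centred_polygons n. area_product L \<le> area_product K}
       = {f ` regular_polygon n r \<theta> | (f :: real^2 \<Rightarrow> real^2) r \<theta>.
            linear f \<and> bij f \<and> r > 0}"
proof (intro equalityI subsetI)
  fix K assume "K \<in> {K \<in> santalo_centred_polygons n. \<forall>L \<in> santalo_centred_polygons n. area_product L \<le> area_product K}"
  then have K: "K \<in> santalo_centred_polygons n" "\<And>L. L \<in> santalo_centred_polygons n \<Longrightarrow> area_product L \<le> area_product K"
    by auto
  \<comment> \<open>A regular polygon attains the bound, so every maximizer attains it as
    well.\<close>
  have "linear (id :: real^2 \<Rightarrow> real^2)" "bij (id :: real^2 \<Rightarrow> real^2)" by (auto simp: linear_id)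
  then have "(real n * sin (pi / n))\<^sup>2 \<le> area_product K"
    using K(2) linear_image_regular_polygon[OF assms, of 1 id 0] by fastforce
  then obtain f where "linear f" "bij f" "K = f ` regular_polygon n 1 0"
    using area_product_le[OF assms K(1)] by fastforce
  then show "K \<in> {f ` regular_polygon n r \<theta> | (f :: real^2 \<Rightarrow> real^2) r \<theta>. linear f \<and> bij f \<and> r > 0}"
    using zero_less_one by blast
next
  fix K assume "K \<in> {f ` regular_polygon n r \<theta> | (f :: real^2 \<Rightarrow> real^2) r \<theta>. linear f \<and> bij f \<and> r > 0}"
  then obtain f :: "real^2 \<Rightarrow> real^2" and r \<theta> where "K = f ` regular_polygon n r \<theta>" "linear f" "bij f" "r > 0"
    by blast
  then show "K \<in> {K \<in> santalo_centred_polygons n. \<forall>L \<in> santalo_centred_polygons n. area_product L \<le> area_product K}"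
    using linear_image_regular_polygon[OF assms, of r f \<theta>] area_product_le(1)[OF assms] by simp
qed

end
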